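(* Let $\mathbb{X}$ be an extensive restriction category equipped with a Kleene wand $\circledast$ for $\perp_d$ (that is, $(\mathbb{X},\circledast)$ is a $\perp_d$-itegory). Then $\mathbb{X}$ has a parametrized iteration operator $\mathsf{Iter}$ defined on a map $\begin{bmatrix} f_1&f_2\end{bmatrix}:X\to X+A$ by $$\mathsf{Iter}^X_A\big(\begin{bmatrix} f_1&f_2\end{bmatrix}\big)=f_1\circledast f_2,$$ and the induced trace operator $\mathsf{Tr}$ is given on a map $g:X+A\to X+B$ with components $g_1=\iota_1g\iota_1^\circ:X\to X$, $g_2=\iota_1g\iota_2^\circ:X\to B$, $g_3=\iota_2g\iota_1^\circ:A\to X$, $g_4=\iota_2g\iota_2^\circ:A\to B$ by $$\mathsf{Tr}^X_{A,B}(g)=g_4\sqcup g_3(g_1\circledast g_2).$$ So $\mathbb{X}$ is a traced extensive restriction category. Moreover, if $\circledast$ is uniform, then $\mathsf{Iter}$ and $\mathsf{Tr}$ are uniform.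
   Context: Composition is diagrammatic: $fg$ means first $f$, then $g$. A restriction category is a category with an operator sending each $f:A\to B$ to $\overline{f}:A\to A$ such that $\overline{f}f=f$; $\overline{f}\,\overline{g}=\overline{g}\,\overline{f}$ and $\overline{\overline{g}f}=\overline{g}\,\overline{f}$ for $f:A\to B$, $g:A\to C$; and $f\overline{g}=\overline{fg}f$ for $f:A\to B$, $g:B\to C$. For parallel $f,g$: $f\le g$ iff $\overline{f}g=f$. A map $f:A\to B$ is total if $\overline{f}=1_A$. Restriction zeroes: maps $0:A\to B$ with $f0=0=0f$ and $\overline{0}=0$. A coCartesian restriction category is a restriction category with finite coproducts whose injections $\iota_j$ are total. With restriction zeroes, the quasi-projection $\iota_j^\circ:A_1+\dots+A_n\to A_j$ is the unique map with $\iota_j\iota_j^\circ=1_{A_j}$ and $\iota_i\iota_j^\circ=0$ for $i\ne j$. $\nabla:A+\dots+A\to A$ is the codiagonal; copairing is written as a column. An extensive restriction category is a coCartesian restriction category with restriction zeroes such that for every $f:A\to B_1+\dots+B_n$ there is a (necessarily unique) map $\langle f\rangle:A\to A+\dots+A$ ($n$ copies) with $\overline{f}=\langle f\rangle\nabla$ and $\langle f\rangle(f+\dots+f)=f(\iota_1+\dots+\iota_n)$. A map $d:A\to A+\dots+A$ is a decision if $\langle d\rangle=d$. For $f:A\to B$, $g:A\to C$, $f\perp_d g$ iff there is a (necessarily unique) decision $\langle f\vert g\rangle:A\to A+A$ with $\langle f\vert g\rangle\iota_1^\circ=\overline{f}$, $\langle f\vert g\rangle\iota_2^\circ=\overline{g}$.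 This is an interference relation with all binary joins: for parallel $f\perp_d g:A\to B$, $f\sqcup g:=\langle f\vert g\rangle(f+g)\nabla$ is their least upper bound for $\le$, and it is preserved by precomposition. For $f\perp_d g$, $\begin{bmatrix} f&g\end{bmatrix}:=\langle f\vert g\rangle(f+g):A\to B+C$; every map $h:A\to B+C$ is uniquely of this form, with $f=h\iota_1^\circ$, $g=h\iota_2^\circ$. A Kleene wand $\circledast$ with respect to $\perp=\perp_d$ assigns to each $f:X\to X$, $g:X\to A$ with $f\perp g$ a map $f\circledast g:X\to A$ such that: (1) if $f \perp g$, then $g\sqcup f(f\circledast g)=f\circledast g$; (2) $(f\circledast g)h=f\circledast gh$ for $f\perp g$, $h:A\to B$; (3) for $f:X\to Y$, $g:X\to A$, $k:Y\to X$ with $f\perp g$: $kf\circledast kg=k(fk\circledast g)$; (4) for $f,f':X\to X$, $g:X\to A$ with $f\perp f'$ and $f\sqcup f'\perp g$: $(f\circledast f')\perp(f\circledast g)$ and $(f\sqcup f')\circledast g=(f\circledast f')\circledast(f\circledast g)$. It is uniform if for $f:X\to X$, $g:X\to A$, $f':Y\to Y$, $g':Y\to A$, $h:X\to Y$ with $f\perp g$, $f'\perp g'$, $hg'=g$, $hf'=fh$ one has $h(f'\circledast g')=f\circledast g$. A parametrized iteration operator on a category with finite coproducts is a family of operators $\mathsf{Iter}^X_A$ sending $f:X\to X+A$ to $\mathsf{Iter}^X_A(f):X\to A$ such that: [Parametrized Iteration] $f\left[\begin{smallmatrix}\mathsf{Iter}^X_A(f)\\ 1_A\end{smallmatrix}\right]=\mathsf{Iter}^X_A(f)$;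 [Naturality] $\mathsf{Iter}^X_A(f(1_X+h))=\mathsf{Iter}^X_{A'}(f)h$ for $f:X\to X+A'$, $h:A'\to A$; [Dinaturality] $\mathsf{Iter}^X_A(kf)=k\,\mathsf{Iter}^{X'}_A(f(k+1_A))$ for $f:X'\to X+A$, $k:X\to X'$; [Diagonal] $\mathsf{Iter}^X_A(\mathsf{Iter}^X_{X+A}(f))=\mathsf{Iter}^X_A(f(\nabla_X+1_A))$ for $f:X\to X+X+A$. It is uniform if $f(h+1_A)=hf'$ (with $f:X\to X+A$, $f':Y\to Y+A$, $h:X\to Y$) implies $\mathsf{Iter}^X_A(f)=h\,\mathsf{Iter}^Y_A(f')$. A trace operator for the coproduct sends $f:X+A\to X+B$ to $\mathsf{Tr}^X_{A,B}(f):A\to B$ (associativity isomorphisms suppressed) such that: [Tightening] $\mathsf{Tr}^X((1_X+g)f(1_X+h))=g\,\mathsf{Tr}^X(f)\,h$; [Sliding] $\mathsf{Tr}^X(f(k+1_B))=\mathsf{Tr}^{X'}((k+1_A)f)$ for $f:X+A\to X'+B$, $k:X'\to X$; [Vanishing] $\mathsf{Tr}^{X+Y}(f)=\mathsf{Tr}^Y(\mathsf{Tr}^X(f))$ for $f:X+Y+A\to X+Y+B$; [Superposing] $\mathsf{Tr}^X(f+g)=\mathsf{Tr}^X(f)+g$; [Yanking] $\mathsf{Tr}^X_{X,X}(\sigma)=1_X$ for the symmetry $\sigma:X+X\to X+X$. It is uniform if $f(h+1_B)=(h+1_A)f'$ (with $f:X+A\to X+B$, $f':Y+A\to Y+B$,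 $h:X\to Y$) implies $\mathsf{Tr}^X_{A,B}(f)=\mathsf{Tr}^Y_{A,B}(f')$. Known fact: (uniform) trace operators and (uniform) parametrized iteration operators are in bijection; the trace operator induced by $\mathsf{Iter}$ is $\mathsf{Tr}^X_{A,B}(f)=\iota_2f\left[\begin{smallmatrix}\mathsf{Iter}^X_B(\iota_1f)\\1_B\end{smallmatrix}\right]$. A traced extensive restriction category is an extensive restriction category equipped with a trace operator, equivalently a parametrized iteration operator. *)

theory Defs
  imports Main
begin

section \<open>Restriction categories\<close>

text \<open>
  Composition is diagrammatic: \<open>f \<cdot> g\<close> is first \<open>f\<close>, then \<open>g\<close>. All operations are total
  HOL functions; their values are only constrained on composable arrows of the category.
\<close>

record ('o, 'm) cat =
  Ob :: "'o set"
  Ar :: "'m set"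
  src :: "'m \<Rightarrow> 'o"
  tgt :: "'m \<Rightarrow> 'o"
  idn :: "'o \<Rightarrow> 'm"
  seq :: "'m \<Rightarrow> 'm \<Rightarrow> 'm"  (infixl \<open>\<cdot>\<index>\<close> 70)

definition hom :: "('o, 'm, 'z) cat_scheme \<Rightarrow> 'o \<Rightarrow> 'o \<Rightarrow> 'm set"
  where "hom C A B = {f \<in> Ar C. src C f = A \<and> tgt C f = B}"

locale category =
  fixes C :: "('o, 'm, 'z) cat_scheme" (structure)
  assumes src_Ob: "f \<in> Ar C \<Longrightarrow> src C f \<in> Ob C"
    and tgt_Ob: "f \<in> Ar C \<Longrightarrow> tgt C f \<in> Ob C"
    and idn_hom: "A \<in> Ob C \<Longrightarrow> idn C A \<in> hom C A A"
    and seq_hom: "\<lbrakk>f \<in> hom C A B; g \<in> hom C B D\<rbrakk> \<Longrightarrow> f \<cdot> g \<in> hom C A D"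
    and idn_seq: "f \<in> hom C A B \<Longrightarrow> idn C A \<cdot> f = f"
    and seq_idn: "f \<in> hom C A B \<Longrightarrow> f \<cdot> idn C B = f"
    and seq_assoc: "\<lbrakk>f \<in> hom C A B; g \<in> hom C B D; h \<in> hom C D E\<rbrakk>
      \<Longrightarrow> (f \<cdot> g) \<cdot> h = f \<cdot> (g \<cdot> h)"

record ('o, 'm) rcat = "('o, 'm) cat" +
  restr :: "'m \<Rightarrow> 'm"  (\<open>\<rho>\<index> _\<close> [81] 80)

locale restriction_category = category C
  for C :: "('o, 'm, 'z) rcat_scheme" (structure) +
  assumes restr_hom: "f \<in> hom C A B \<Longrightarrow> \<rho> f \<in> hom C A A"
    and restr_seq_self: "f \<in> hom C A B \<Longrightarrow> \<rho> f \<cdot> f = f"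
    and restr_commute: "\<lbrakk>f \<in> hom C A B; g \<in> hom C A D\<rbrakk> \<Longrightarrow> \<rho> f \<cdot> \<rho> g = \<rho> g \<cdot> \<rho> f"
    and restr_restr_seq: "\<lbrakk>f \<in> hom C A B; g \<in> hom C A D\<rbrakk> \<Longrightarrow> \<rho> (\<rho> g \<cdot> f) = \<rho> g \<cdot> \<rho> f"
    and seq_restr: "\<lbrakk>f \<in> hom C A B; g \<in> hom C B D\<rbrakk> \<Longrightarrow> f \<cdot> \<rho> g = \<rho> (f \<cdot> g) \<cdot> f"

definition total_map :: "('o, 'm, 'z) rcat_scheme \<Rightarrow> 'm \<Rightarrow> bool"
  where "total_map C f \<longleftrightarrow> \<rho>\<^bsub>C\<^esub> f = idn C (src C f)"


section \<open>Finite coproducts and restriction zeroes\<close>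

text \<open>
  Finite coproducts are chosen: \<open>csum C [A\<^sub>1, \<dots>, A\<^sub>n]\<close> is the coproduct of a finite list
  of objects, and \<open>cinj C [A\<^sub>1, \<dots>, A\<^sub>n] j\<close> is its injection from the entry at position \<open>j\<close>,
  counted from \<open>0\<close>. A coproduct object need not determine its summands, so operations
  depending on the summands take them as arguments.
\<close>

record ('o, 'm) crcat = "('o, 'm) rcat" +
  csum :: "'o list \<Rightarrow> 'o"
  cinj :: "'o list \<Rightarrow> nat \<Rightarrow> 'm"
  zer :: "'o \<Rightarrow> 'o \<Rightarrow> 'm"

locale cocartesian_restriction_category = restriction_category C
  for C :: "('o, 'm, 'z) crcat_scheme" (structure) +
  assumes csum_Ob: "set As \<subseteq> Ob C \<Longrightarrow> csum C As \<in> Ob C"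
    and cinj_hom: "\<lbrakk>set As \<subseteq> Ob C; j < length As\<rbrakk> \<Longrightarrow> cinj C As j \<in> hom C (As ! j) (csum C As)"
    and csum_universal:
      "\<lbrakk>set As \<subseteq> Ob C; D \<in> Ob C; length fs = length As;
        \<And>j. j < length As \<Longrightarrow> fs ! j \<in> hom C (As ! j) D\<rbrakk>
       \<Longrightarrow> \<exists>!h. h \<in> hom C (csum C As) D \<and> (\<forall>j < length As. cinj C As j \<cdot> h = fs ! j)"
    and cinj_total: "\<lbrakk>set As \<subseteq> Ob C; j < length As\<rbrakk> \<Longrightarrow> total_map C (cinj C As j)"

locale cocartesian_restriction_category_zero = cocartesian_restriction_category C
  for C :: "('o, 'm, 'z) crcat_scheme" (structure) +
  assumes zer_hom: "\<lbrakk>A \<in> Ob C; B \<in> Ob C\<rbrakk> \<Longrightarrow> zer C A B \<in> hom C A B"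
    and seq_zer: "\<lbrakk>f \<in> hom C A B; D \<in> Ob C\<rbrakk> \<Longrightarrow> f \<cdot> zer C B D = zer C A D"
    and zer_seq: "\<lbrakk>f \<in> hom C A B; D \<in> Ob C\<rbrakk> \<Longrightarrow> zer C D A \<cdot> f = zer C D B"
    and restr_zer: "\<lbrakk>A \<in> Ob C; B \<in> Ob C\<rbrakk> \<Longrightarrow> \<rho> (zer C A B) = zer C A A"

text \<open>The target \<open>D\<close> is an argument because \<open>fs\<close> may be empty.\<close>

definition cotuple :: "('o, 'm, 'z) crcat_scheme \<Rightarrow> 'o \<Rightarrow> 'm list \<Rightarrow> 'm"
  where "cotuple C D fs =
    (THE h. h \<in> hom C (csum C (map (src C) fs)) D \<and>
       (\<forall>j < length fs. cinj C (map (src C) fs) j \<cdot>\<^bsub>C\<^esub> h = fs ! j))"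

text \<open>\<open>f\<^sub>1 + \<dots> + f\<^sub>n\<close>\<close>

definition csum_map :: "('o, 'm, 'z) crcat_scheme \<Rightarrow> 'm list \<Rightarrow> 'm"
  where "csum_map C fs = cotuple C (csum C (map (tgt C) fs))
    (map (\<lambda>j. fs ! j \<cdot>\<^bsub>C\<^esub> cinj C (map (tgt C) fs) j) [0..<length fs])"

text \<open>\<open>\<nabla> : A + \<dots> + A \<rightarrow> A\<close>, with \<open>n\<close> copies of \<open>A\<close>\<close>

definition codiag :: "('o, 'm, 'z) crcat_scheme \<Rightarrow> nat \<Rightarrow> 'o \<Rightarrow> 'm"
  where "codiag C n A = cotuple C A (replicate n (idn C A))"

text \<open>The quasi-projection from \<open>A\<^sub>1 + \<dots> + A\<^sub>n\<close> to the entry at position \<open>j\<close>\<close>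

definition qproj :: "('o, 'm, 'z) crcat_scheme \<Rightarrow> 'o list \<Rightarrow> nat \<Rightarrow> 'm"
  where "qproj C As j =
    (THE p. p \<in> hom C (csum C As) (As ! j) \<and>
       (\<forall>i < length As. cinj C As i \<cdot>\<^bsub>C\<^esub> p =
          (if i = j then idn C (As ! j) else zer C (As ! i) (As ! j))))"

abbreviation bsum :: "('o, 'm, 'z) crcat_scheme \<Rightarrow> 'o \<Rightarrow> 'o \<Rightarrow> 'o"  (infixl \<open>\<uplus>\<index>\<close> 65)
  where "A \<uplus>\<^bsub>C\<^esub> B \<equiv> csum C [A, B]"

abbreviation in1 :: "('o, 'm, 'z) crcat_scheme \<Rightarrow> 'o \<Rightarrow> 'o \<Rightarrow> 'm"
  where "in1 C A B \<equiv> cinj C [A, B] 0"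

abbreviation in2 :: "('o, 'm, 'z) crcat_scheme \<Rightarrow> 'o \<Rightarrow> 'o \<Rightarrow> 'm"
  where "in2 C A B \<equiv> cinj C [A, B] 1"

abbreviation qp1 :: "('o, 'm, 'z) crcat_scheme \<Rightarrow> 'o \<Rightarrow> 'o \<Rightarrow> 'm"
  where "qp1 C A B \<equiv> qproj C [A, B] 0"

abbreviation qp2 :: "('o, 'm, 'z) crcat_scheme \<Rightarrow> 'o \<Rightarrow> 'o \<Rightarrow> 'm"
  where "qp2 C A B \<equiv> qproj C [A, B] 1"

abbreviation bsum_map :: "('o, 'm, 'z) crcat_scheme \<Rightarrow> 'm \<Rightarrow> 'm \<Rightarrow> 'm"  (infixl \<open>\<oplus>\<index>\<close> 65)
  where "f \<oplus>\<^bsub>C\<^esub> g \<equiv> csum_map C [f, g]"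

definition copair :: "('o, 'm, 'z) crcat_scheme \<Rightarrow> 'm \<Rightarrow> 'm \<Rightarrow> 'm"
  where "copair C f g = cotuple C (tgt C f) [f, g]"

definition assoc_l :: "('o, 'm, 'z) crcat_scheme \<Rightarrow> 'o \<Rightarrow> 'o \<Rightarrow> 'o \<Rightarrow> 'm"
  \<comment> \<open>\<open>A + (B + D) \<rightarrow> (A + B) + D\<close>\<close>
  where "assoc_l C A B D =
    copair C (in1 C A B \<cdot> in1 C (A \<uplus> B) D)
      (copair C (in2 C A B \<cdot> in1 C (A \<uplus> B) D) (in2 C (A \<uplus> B) D))"
  for C (structure)

definition assoc_r :: "('o, 'm, 'z) crcat_scheme \<Rightarrow> 'o \<Rightarrow> 'o \<Rightarrow> 'o \<Rightarrow> 'm"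
  \<comment> \<open>\<open>(A + B) + D \<rightarrow> A + (B + D)\<close>\<close>
  where "assoc_r C A B D =
    copair C (copair C (in1 C A (B \<uplus> D)) (in1 C B D \<cdot> in2 C A (B \<uplus> D)))
      (in2 C B D \<cdot> in2 C A (B \<uplus> D))"
  for C (structure)

definition symm :: "('o, 'm, 'z) crcat_scheme \<Rightarrow> 'o \<Rightarrow> 'o \<Rightarrow> 'm"
  \<comment> \<open>\<open>A + B \<rightarrow> B + A\<close>\<close>
  where "symm C A B = copair C (in2 C B A) (in1 C B A)"


section \<open>Extensive restriction categories\<close>

text \<open>
  For \<open>f : A \<rightarrow> B\<^sub>1 + \<dots> + B\<^sub>n\<close>, \<open>is_dec_of C Bs f d\<close> says that \<open>d\<close> has the properties
  defining \<open>\<langle>f\<rangle> : A \<rightarrow> A + \<dots> + A\<close>.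
\<close>

definition is_dec_of :: "('o, 'm, 'z) crcat_scheme \<Rightarrow> 'o list \<Rightarrow> 'm \<Rightarrow> 'm \<Rightarrow> bool"
  where "is_dec_of C Bs f d \<longleftrightarrow>
    d \<in> hom C (src C f) (csum C (replicate (length Bs) (src C f))) \<and>
    \<rho> f = d \<cdot> codiag C (length Bs) (src C f) \<and>
    d \<cdot> csum_map C (replicate (length Bs) f) =
      f \<cdot> csum_map C (map (cinj C Bs) [0..<length Bs])"
  for C (structure)

definition dec_of :: "('o, 'm, 'z) crcat_scheme \<Rightarrow> 'o list \<Rightarrow> 'm \<Rightarrow> 'm"
  where "dec_of C Bs f = (THE d. is_dec_of C Bs f d)"

locale extensive_restriction_category = cocartesian_restriction_category_zero C
  for C :: "('o, 'm, 'z) crcat_scheme" (structure) +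
  assumes dec_exists: "\<lbrakk>set Bs \<subseteq> Ob C; f \<in> hom C A (csum C Bs)\<rbrakk> \<Longrightarrow> \<exists>d. is_dec_of C Bs f d"

definition decision :: "('o, 'm, 'z) crcat_scheme \<Rightarrow> nat \<Rightarrow> 'o \<Rightarrow> 'm \<Rightarrow> bool"
  where "decision C n A d \<longleftrightarrow>
    d \<in> hom C A (csum C (replicate n A)) \<and> dec_of C (replicate n A) d = d"

text \<open>\<open>is_dec2 C f g d\<close>: the map \<open>d\<close> has the properties defining \<open>\<langle>f|g\<rangle> : A \<rightarrow> A + A\<close>.\<close>

definition is_dec2 :: "('o, 'm, 'z) crcat_scheme \<Rightarrow> 'm \<Rightarrow> 'm \<Rightarrow> 'm \<Rightarrow> bool"
  where "is_dec2 C f g d \<longleftrightarrow>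
    decision C 2 (src C f) d \<and>
    d \<cdot> qp1 C (src C f) (src C f) = \<rho> f \<and>
    d \<cdot> qp2 C (src C f) (src C f) = \<rho> g"
  for C (structure)

definition perp :: "('o, 'm, 'z) crcat_scheme \<Rightarrow> 'm \<Rightarrow> 'm \<Rightarrow> bool"  (infix \<open>\<bottom>\<index>\<close> 50)
  where "f \<bottom>\<^bsub>C\<^esub> g \<longleftrightarrow> f \<in> Ar C \<and> g \<in> Ar C \<and> src C f = src C g \<and> (\<exists>d. is_dec2 C f g d)"

definition dec2 :: "('o, 'm, 'z) crcat_scheme \<Rightarrow> 'm \<Rightarrow> 'm \<Rightarrow> 'm"
  where "dec2 C f g = (THE d. is_dec2 C f g d)"

definition join :: "('o, 'm, 'z) crcat_scheme \<Rightarrow> 'm \<Rightarrow> 'm \<Rightarrow> 'm"  (infixl \<open>\<squnion>\<index>\<close> 65)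
  where "f \<squnion>\<^bsub>C\<^esub> g = dec2 C f g \<cdot>\<^bsub>C\<^esub> (f \<oplus>\<^bsub>C\<^esub> g) \<cdot>\<^bsub>C\<^esub> codiag C 2 (tgt C f)"

text \<open>The row \<open>[f g] : A \<rightarrow> B + C\<close>, for disjoint \<open>f : A \<rightarrow> B\<close> and \<open>g : A \<rightarrow> C\<close>\<close>

definition row :: "('o, 'm, 'z) crcat_scheme \<Rightarrow> 'm \<Rightarrow> 'm \<Rightarrow> 'm"
  where "row C f g = dec2 C f g \<cdot>\<^bsub>C\<^esub> (f \<oplus>\<^bsub>C\<^esub> g)"


section \<open>Kleene wands\<close>

locale kleene_wand =
  fixes C :: "('o, 'm, 'z) crcat_scheme" (structure)
    and wand :: "'m \<Rightarrow> 'm \<Rightarrow> 'm"  (infixl \<open>\<star>\<close> 70)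
  assumes wand_hom:
      "\<lbrakk>f \<in> hom C X X; g \<in> hom C X A; f \<bottom> g\<rbrakk> \<Longrightarrow> f \<star> g \<in> hom C X A"
    and wand_iteration:
      "\<lbrakk>f \<in> hom C X X; g \<in> hom C X A; f \<bottom> g\<rbrakk> \<Longrightarrow> g \<squnion> f \<cdot> (f \<star> g) = f \<star> g"
    and wand_natural:
      "\<lbrakk>f \<in> hom C X X; g \<in> hom C X A; h \<in> hom C A B; f \<bottom> g\<rbrakk>
       \<Longrightarrow> (f \<star> g) \<cdot> h = f \<star> (g \<cdot> h)"
    and wand_dinatural:
      "\<lbrakk>f \<in> hom C X Y; g \<in> hom C X A; k \<in> hom C Y X; f \<bottom> g\<rbrakk>
       \<Longrightarrow> (k \<cdot> f) \<star> (k \<cdot> g) = k \<cdot> ((f \<cdot> k) \<star> g)"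
    and wand_diagonal_perp:
      "\<lbrakk>f \<in> hom C X X; f' \<in> hom C X X; g \<in> hom C X A; f \<bottom> f'; (f \<squnion> f') \<bottom> g\<rbrakk>
       \<Longrightarrow> (f \<star> f') \<bottom> (f \<star> g)"
    and wand_diagonal:
      "\<lbrakk>f \<in> hom C X X; f' \<in> hom C X X; g \<in> hom C X A; f \<bottom> f'; (f \<squnion> f') \<bottom> g\<rbrakk>
       \<Longrightarrow> (f \<squnion> f') \<star> g = (f \<star> f') \<star> (f \<star> g)"

definition uniform_wand :: "('o, 'm, 'z) crcat_scheme \<Rightarrow> ('m \<Rightarrow> 'm \<Rightarrow> 'm) \<Rightarrow> bool"
  where "uniform_wand C W \<longleftrightarrow>
    (\<forall>X Y A f g f' g' h.
       f \<in> hom C X X \<longrightarrow> g \<in> hom C X A \<longrightarrow> f' \<in> hom C Y Y \<longrightarrow> g' \<in> hom C Y A \<longrightarrow>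
       h \<in> hom C X Y \<longrightarrow> f \<bottom> g \<longrightarrow> f' \<bottom> g' \<longrightarrow> h \<cdot> g' = g \<longrightarrow> h \<cdot> f' = f \<cdot> h \<longrightarrow>
       h \<cdot> W f' g' = W f g)"
  for C (structure)


section \<open>Parametrized iteration operators\<close>

locale parametrized_iteration_operator =
  fixes C :: "('o, 'm, 'z) crcat_scheme" (structure)
    and Iter :: "'o \<Rightarrow> 'o \<Rightarrow> 'm \<Rightarrow> 'm"
  assumes Iter_hom:
      "\<lbrakk>X \<in> Ob C; A \<in> Ob C; f \<in> hom C X (X \<uplus> A)\<rbrakk> \<Longrightarrow> Iter X A f \<in> hom C X A"
    and Iter_iteration:
      "\<lbrakk>X \<in> Ob C; A \<in> Ob C; f \<in> hom C X (X \<uplus> A)\<rbrakk>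
       \<Longrightarrow> f \<cdot> copair C (Iter X A f) (idn C A) = Iter X A f"
    and Iter_natural:
      "\<lbrakk>X \<in> Ob C; A \<in> Ob C; A' \<in> Ob C; f \<in> hom C X (X \<uplus> A'); h \<in> hom C A' A\<rbrakk>
       \<Longrightarrow> Iter X A (f \<cdot> (idn C X \<oplus> h)) = Iter X A' f \<cdot> h"
    and Iter_dinatural:
      "\<lbrakk>X \<in> Ob C; X' \<in> Ob C; A \<in> Ob C; f \<in> hom C X' (X \<uplus> A); k \<in> hom C X X'\<rbrakk>
       \<Longrightarrow> Iter X A (k \<cdot> f) = k \<cdot> Iter X' A (f \<cdot> (k \<oplus> idn C A))"
    and Iter_diagonal:
      "\<lbrakk>X \<in> Ob C; A \<in> Ob C; f \<in> hom C X (X \<uplus> (X \<uplus> A))\<rbrakk>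
       \<Longrightarrow> Iter X A (Iter X (X \<uplus> A) f) =
          Iter X A (f \<cdot> assoc_l C X X A \<cdot> (codiag C 2 X \<oplus> idn C A))"

definition uniform_iteration ::
    "('o, 'm, 'z) crcat_scheme \<Rightarrow> ('o \<Rightarrow> 'o \<Rightarrow> 'm \<Rightarrow> 'm) \<Rightarrow> bool"
  where "uniform_iteration C Iter \<longleftrightarrow>
    (\<forall>X \<in> Ob C. \<forall>Y \<in> Ob C. \<forall>A \<in> Ob C.
     \<forall>f \<in> hom C X (X \<uplus> A). \<forall>f' \<in> hom C Y (Y \<uplus> A). \<forall>h \<in> hom C X Y.
       f \<cdot> (h \<oplus> idn C A) = h \<cdot> f' \<longrightarrow> Iter X A f = h \<cdot> Iter Y A f')"
  for C (structure)


section \<open>Trace operators\<close>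

locale trace_operator =
  fixes C :: "('o, 'm, 'z) crcat_scheme" (structure)
    and Tr :: "'o \<Rightarrow> 'o \<Rightarrow> 'o \<Rightarrow> 'm \<Rightarrow> 'm"
  assumes Tr_hom:
      "\<lbrakk>X \<in> Ob C; A \<in> Ob C; B \<in> Ob C; f \<in> hom C (X \<uplus> A) (X \<uplus> B)\<rbrakk>
       \<Longrightarrow> Tr X A B f \<in> hom C A B"
    and Tr_tightening:
      "\<lbrakk>X \<in> Ob C; A \<in> Ob C; A' \<in> Ob C; B \<in> Ob C; B' \<in> Ob C;
        f \<in> hom C (X \<uplus> A) (X \<uplus> B); g \<in> hom C A' A; h \<in> hom C B B'\<rbrakk>
       \<Longrightarrow> Tr X A' B' ((idn C X \<oplus> g) \<cdot> f \<cdot> (idn C X \<oplus> h)) = g \<cdot> Tr X A B f \<cdot> h"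
    and Tr_sliding:
      "\<lbrakk>X \<in> Ob C; X' \<in> Ob C; A \<in> Ob C; B \<in> Ob C;
        f \<in> hom C (X \<uplus> A) (X' \<uplus> B); k \<in> hom C X' X\<rbrakk>
       \<Longrightarrow> Tr X A B (f \<cdot> (k \<oplus> idn C B)) = Tr X' A B ((k \<oplus> idn C A) \<cdot> f)"
    and Tr_vanishing:
      "\<lbrakk>X \<in> Ob C; Y \<in> Ob C; A \<in> Ob C; B \<in> Ob C;
        f \<in> hom C ((X \<uplus> Y) \<uplus> A) ((X \<uplus> Y) \<uplus> B)\<rbrakk>
       \<Longrightarrow> Tr (X \<uplus> Y) A B f =
          Tr Y A B (Tr X (Y \<uplus> A) (Y \<uplus> B) (assoc_l C X Y A \<cdot> f \<cdot> assoc_r C X Y B))"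
    and Tr_superposing:
      "\<lbrakk>X \<in> Ob C; A \<in> Ob C; B \<in> Ob C; D \<in> Ob C; E \<in> Ob C;
        f \<in> hom C (X \<uplus> A) (X \<uplus> B); g \<in> hom C D E\<rbrakk>
       \<Longrightarrow> Tr X (A \<uplus> D) (B \<uplus> E) (assoc_l C X A D \<cdot> (f \<oplus> g) \<cdot> assoc_r C X B E) =
          Tr X A B f \<oplus> g"
    and Tr_yanking:
      "X \<in> Ob C \<Longrightarrow> Tr X X X (symm C X X) = idn C X"

definition uniform_trace ::
    "('o, 'm, 'z) crcat_scheme \<Rightarrow> ('o \<Rightarrow> 'o \<Rightarrow> 'o \<Rightarrow> 'm \<Rightarrow> 'm) \<Rightarrow> bool"
  where "uniform_trace C Tr \<longleftrightarrow>
    (\<forall>X \<in> Ob C. \<forall>Y \<in> Ob C. \<forall>A \<in> Ob C. \<forall>B \<in> Ob C.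
     \<forall>f \<in> hom C (X \<uplus> A) (X \<uplus> B). \<forall>f' \<in> hom C (Y \<uplus> A) (Y \<uplus> B). \<forall>h \<in> hom C X Y.
       f \<cdot> (h \<oplus> idn C B) = (h \<oplus> idn C A) \<cdot> f' \<longrightarrow> Tr X A B f = Tr Y A B f')"
  for C (structure)

locale traced_extensive_restriction_category =
  extensive_restriction_category C + trace_operator C Tr
  for C :: "('o, 'm, 'z) crcat_scheme" (structure) and Tr

definition iter_trace ::
    "('o, 'm, 'z) crcat_scheme \<Rightarrow> ('o \<Rightarrow> 'o \<Rightarrow> 'm \<Rightarrow> 'm) \<Rightarrow> 'o \<Rightarrow> 'o \<Rightarrow> 'o \<Rightarrow> 'm \<Rightarrow> 'm"
  where "iter_trace C Iter X A B f =
    in2 C X A \<cdot> f \<cdot> copair C (Iter X B (in1 C X A \<cdot> f)) (idn C B)"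
  for C (structure)


section \<open>The iteration operator of a Kleene wand\<close>

text \<open>
  The value at \<open>h = [f\<^sub>1 f\<^sub>2] : X \<rightarrow> X + A\<close> is the wand applied to \<open>f\<^sub>1\<close> and \<open>f\<^sub>2\<close>. In an
  extensive restriction category every \<open>h\<close> is a row in exactly one way.
\<close>

definition wand_iter ::
    "('o, 'm, 'z) crcat_scheme \<Rightarrow> ('m \<Rightarrow> 'm \<Rightarrow> 'm) \<Rightarrow> 'o \<Rightarrow> 'o \<Rightarrow> 'm \<Rightarrow> 'm"
  where "wand_iter C W X A h =
    (THE m. \<exists>f\<^sub>1 \<in> hom C X X. \<exists>f\<^sub>2 \<in> hom C X A. f\<^sub>1 \<bottom> f\<^sub>2 \<and> h = row C f\<^sub>1 f\<^sub>2 \<and> m = W f\<^sub>1 f\<^sub>2)"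
  for C (structure)

end

theory Submission
  imports Defs
begin

text \<open>
  In an extensive restriction category the two quasi-projections out of a binary coproduct are
  jointly monic, and \<open>f \<bottom> g\<close> holds exactly when \<open>f\<close> and \<open>g\<close> are the components of a (unique) map
  into the coproduct, namely the row \<open>[f g]\<close>. Hence the wand iteration operator sends \<open>h\<close> to the
  wand of its two components, and each iteration axiom is the wand axiom of the same name read off
  on components. The trace axioms follow from the iteration axioms in any category with binary
  coproducts; only vanishing is not immediate, and it rests on Bekic's identity.
\<close>

section \<open>Restriction categories with binary coproducts\<close>

text \<open>
  Typing is phrased through \<open>Ar\<close>, \<open>src\<close> and \<open>tgt\<close> instead of \<open>hom\<close>, so that the side conditions of
  the rewrite rules have no extra variables. All canonical maps between binary coproducts are
  rewritten to copairings.
\<close>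

declare One_nat_def [simp del]

lemma hom_iff: "f \<in> hom C A B \<longleftrightarrow> f \<in> Ar C \<and> src C f = A \<and> tgt C f = B"
  by (auto simp: hom_def)

context category
begin

lemma hom_Ob: "f \<in> hom C A B \<Longrightarrow> A \<in> Ob C" "f \<in> hom C A B \<Longrightarrow> B \<in> Ob C"
  using src_Ob tgt_Ob by (auto simp: hom_iff)

lemma idn_Ar [simp]: "A \<in> Ob C \<Longrightarrow> idn C A \<in> Ar C"
  and src_idn [simp]: "A \<in> Ob C \<Longrightarrow> src C (idn C A) = A"
  and tgt_idn [simp]: "A \<in> Ob C \<Longrightarrow> tgt C (idn C A) = A"
  using idn_hom by (auto simp: hom_iff)

lemma
  assumes "f \<in> Ar C" "g \<in> Ar C" "tgt C f = src C g"
  shows seq_Ar [simp]: "f \<cdot> g \<in> Ar C"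
    and src_seq [simp]: "src C (f \<cdot> g) = src C f"
    and tgt_seq [simp]: "tgt C (f \<cdot> g) = tgt C g"
  using seq_hom[of f "src C f" "src C g" g "tgt C g"] assms by (auto simp: hom_iff)

lemma idn_seq_Ar [simp]: "f \<in> Ar C \<Longrightarrow> src C f = A \<Longrightarrow> idn C A \<cdot> f = f"
  and seq_idn_Ar [simp]: "f \<in> Ar C \<Longrightarrow> tgt C f = A \<Longrightarrow> f \<cdot> idn C A = f"
  using idn_seq seq_idn by (auto simp: hom_iff)

lemma seq_assoc_Ar [simp]:
  "\<lbrakk>f \<in> Ar C; g \<in> Ar C; h \<in> Ar C; tgt C f = src C g; tgt C g = src C h\<rbrakk>
   \<Longrightarrow> (f \<cdot> g) \<cdot> h = f \<cdot> (g \<cdot> h)"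
  using seq_assoc[of f "src C f" "src C g" g "src C h" h "tgt C h"] by (auto simp: hom_iff)

lemmas [simp] = src_Ob tgt_Ob

end

section \<open>Calculus of restriction idempotents\<close>

context restriction_category
begin

lemma restr_Ar [simp]: "f \<in> Ar C \<Longrightarrow> \<rho> f \<in> Ar C"
  and src_restr [simp]: "f \<in> Ar C \<Longrightarrow> src C (\<rho> f) = src C f"
  and tgt_restr [simp]: "f \<in> Ar C \<Longrightarrow> tgt C (\<rho> f) = src C f"
  using restr_hom by (auto simp: hom_iff)

lemma restr_seq_Ar [simp]: "f \<in> Ar C \<Longrightarrow> \<rho> f \<cdot> f = f"
  using restr_seq_self by (auto simp: hom_iff)

lemma restr_commute_Ar: "\<lbrakk>f \<in> Ar C; g \<in> Ar C; src C f = src C g\<rbrakk> \<Longrightarrow> \<rho> f \<cdot> \<rho> g = \<rho> g \<cdot> \<rho> f"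
  using restr_commute by (auto simp: hom_iff)

lemma restr_restr_seq_Ar:
  "\<lbrakk>f \<in> Ar C; g \<in> Ar C; src C f = src C g\<rbrakk> \<Longrightarrow> \<rho> (\<rho> g \<cdot> f) = \<rho> g \<cdot> \<rho> f"
  using restr_restr_seq by (auto simp: hom_iff)

lemma seq_restr_Ar: "\<lbrakk>f \<in> Ar C; g \<in> Ar C; tgt C f = src C g\<rbrakk> \<Longrightarrow> f \<cdot> \<rho> g = \<rho> (f \<cdot> g) \<cdot> f"
  using seq_restr by (auto simp: hom_iff)

lemma restr_idn [simp]: "A \<in> Ob C \<Longrightarrow> \<rho> (idn C A) = idn C A"
  using restr_seq_Ar[of "idn C A"] seq_idn_Ar[of "\<rho> (idn C A)" A] by simp

lemma restr_restr [simp]: "f \<in> Ar C \<Longrightarrow> \<rho> (\<rho> f) = \<rho> f"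
  using restr_restr_seq_Ar[of "idn C (src C f)" f] by simp

text \<open>Moving \<open>\<rho> g\<close> to the front of \<open>f\<close> turns it into
  \<open>\<rho> (f \<cdot> g)\<close>; the factor \<open>\<rho> f\<close> that then splits off is
  absorbed by \<open>f\<close>.\<close>

lemma restr_seq_restr:
  assumes [simp]: "f \<in> Ar C" "g \<in> Ar C" "tgt C f = src C g"
  shows "\<rho> (f \<cdot> \<rho> g) = \<rho> (f \<cdot> g)"
proof -
  have "\<rho> (f \<cdot> \<rho> g) = \<rho> (f \<cdot> g) \<cdot> \<rho> f"
    by (subst seq_restr_Ar) (simp_all add: restr_restr_seq_Ar)
  also have "\<dots> = \<rho> f \<cdot> \<rho> (f \<cdot> g)"
    by (simp add: restr_commute_Ar)
  also have "\<dots> = \<rho> ((\<rho> f \<cdot> f) \<cdot> g)"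
    by (simp add: restr_restr_seq_Ar[symmetric] del: restr_seq_Ar)
  finally show ?thesis by simp
qed

lemma restr_seq_total:
  assumes "f \<in> Ar C" "g \<in> Ar C" "tgt C f = src C g" "total_map C g"
  shows "\<rho> (f \<cdot> g) = \<rho> f"
  using restr_seq_restr[of f g] assms by (simp add: total_map_def)

text \<open>Taking restrictions of both hypotheses gives
  \<open>\<rho> f = \<rho> f \<cdot> \<rho> g = \<rho> g\<close>, so
  \<open>f = \<rho> g \<cdot> g = g\<close>.\<close>

lemma restriction_order_antisym:
  assumes [simp]: "f \<in> Ar C" "g \<in> Ar C" "src C f = src C g"
    and f: "\<rho> f \<cdot> g = f" and g: "\<rho> g \<cdot> f = g"
  shows "f = g"
proof -
  have "\<rho> f = \<rho> f \<cdot> \<rho> g" using restr_restr_seq_Ar[of g f] f by simp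
  also have "\<dots> = \<rho> g \<cdot> \<rho> f" by (simp add: restr_commute_Ar)
  also have "\<dots> = \<rho> g" using restr_restr_seq_Ar[of f g] g by simp
  finally show ?thesis using f by simp
qed

end

section \<open>Injections, copairings and their restrictions\<close>

context cocartesian_restriction_category
begin

lemma bsum_Ob [simp]: "\<lbrakk>A \<in> Ob C; B \<in> Ob C\<rbrakk> \<Longrightarrow> A \<uplus> B \<in> Ob C"
  by (simp add: csum_Ob)

lemma in_Ar [simp]:
  assumes "A \<in> Ob C" "B \<in> Ob C"
  shows "in1 C A B \<in> Ar C" "src C (in1 C A B) = A" "tgt C (in1 C A B) = A \<uplus> B"
    "in2 C A B \<in> Ar C" "src C (in2 C A B) = B" "tgt C (in2 C A B) = A \<uplus> B"
  using cinj_hom[of "[A, B]" 0] cinj_hom[of "[A, B]" 1] assms by (auto simp: hom_iff)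

lemma in_total:
  assumes "A \<in> Ob C" "B \<in> Ob C"
  shows "total_map C (in1 C A B)" "total_map C (in2 C A B)"
  using cinj_total[of "[A, B]" 0] cinj_total[of "[A, B]" 1] assms by auto

lemma restr_in [simp]:
  assumes "A \<in> Ob C" "B \<in> Ob C"
  shows "\<rho> (in1 C A B) = idn C A" "\<rho> (in2 C A B) = idn C B"
  using in_total[OF assms] assms by (auto simp: total_map_def)

lemma restr_seq_in [simp]:
  assumes "A \<in> Ob C" "B \<in> Ob C" "f \<in> Ar C"
  shows "tgt C f = A \<Longrightarrow> \<rho> (f \<cdot> in1 C A B) = \<rho> f"
    and "tgt C f = B \<Longrightarrow> \<rho> (f \<cdot> in2 C A B) = \<rho> f"
  using assms by (simp_all add: restr_seq_total in_total)

lemma all_less_2: "(\<forall>j < 2. P j) \<longleftrightarrow> P 0 \<and> P (1 :: nat)"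
  by (auto simp: less_2_cases_iff One_nat_def)

lemma bsum_universal:
  assumes "f \<in> Ar C" "g \<in> Ar C" "tgt C f = D" "tgt C g = D"
  shows "\<exists>!h. h \<in> hom C (src C f \<uplus> src C g) D \<and>
    in1 C (src C f) (src C g) \<cdot> h = f \<and> in2 C (src C f) (src C g) \<cdot> h = g"
proof -
  have "\<exists>!h. h \<in> hom C (src C f \<uplus> src C g) D \<and>
      (\<forall>j < length [src C f, src C g]. cinj C [src C f, src C g] j \<cdot> h = [f, g] ! j)"
    using assms by (intro csum_universal) (auto simp: hom_iff less_Suc_eq)
  then show ?thesis by (simp add: numeral_2_eq_2[symmetric] all_less_2)
qed

lemma bsum_eqI:
  assumes [simp]: "A \<in> Ob C" "B \<in> Ob C" and "h \<in> Ar C" "h' \<in> Ar C"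
    and "src C h = A \<uplus> B" "src C h' = A \<uplus> B" "tgt C h = tgt C h'"
    and "in1 C A B \<cdot> h = in1 C A B \<cdot> h'" "in2 C A B \<cdot> h = in2 C A B \<cdot> h'"
  shows "h = h'"
  using bsum_universal[of "in1 C A B \<cdot> h" "in2 C A B \<cdot> h" "tgt C h"] assms
  by (simp add: hom_iff) blast

lemma copair_props:
  assumes "f \<in> Ar C" "g \<in> Ar C" "tgt C f = tgt C g"
  shows "copair C f g \<in> hom C (src C f \<uplus> src C g) (tgt C f) \<and>
    in1 C (src C f) (src C g) \<cdot> copair C f g = f \<and> in2 C (src C f) (src C g) \<cdot> copair C f g = g"
proof -
  have eq: "copair C f g = (THE h. h \<in> hom C (src C f \<uplus> src C g) (tgt C f) \<and>
      in1 C (src C f) (src C g) \<cdot> h = f \<and> in2 C (src C f) (src C g) \<cdot> h = g)"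
    by (simp add: copair_def cotuple_def numeral_2_eq_2[symmetric] all_less_2)
  show ?thesis
    unfolding eq by (rule theI'[OF bsum_universal]) (use assms in auto)
qed

lemma copair_Ar [simp]:
  assumes "f \<in> Ar C" "g \<in> Ar C" "tgt C f = tgt C g"
  shows "copair C f g \<in> Ar C" "src C (copair C f g) = src C f \<uplus> src C g"
    "tgt C (copair C f g) = tgt C g"
  using copair_props[OF assms] assms by (auto simp: hom_iff)

lemma in_copair [simp]:
  assumes "f \<in> Ar C" "g \<in> Ar C" "tgt C f = tgt C g" "src C f = A" "src C g = B"
  shows "in1 C A B \<cdot> copair C f g = f" "in2 C A B \<cdot> copair C f g = g"
  using copair_props[OF assms(1-3)] assms by auto

text \<open>Composites are normalised to the right, which hides an injection followed by a copairing
  inside a longer composite; this form finds it there.\<close>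

lemma in_copair_seq [simp]:
  assumes "f \<in> Ar C" "g \<in> Ar C" "tgt C f = tgt C g" "src C f = A" "src C g = B"
    and "h \<in> Ar C" "src C h = tgt C g"
  shows "in1 C A B \<cdot> (copair C f g \<cdot> h) = f \<cdot> h" "in2 C A B \<cdot> (copair C f g \<cdot> h) = g \<cdot> h"
proof -
  have "A \<in> Ob C" "B \<in> Ob C" using assms by auto
  with assms show "in1 C A B \<cdot> (copair C f g \<cdot> h) = f \<cdot> h" "in2 C A B \<cdot> (copair C f g \<cdot> h) = g \<cdot> h"
    by (simp_all add: seq_assoc_Ar[symmetric] del: seq_assoc_Ar)
qed

lemma copair_seq [simp]:
  assumes "f \<in> Ar C" "g \<in> Ar C" "tgt C f = tgt C g" "h \<in> Ar C" "src C h = tgt C g"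
  shows "copair C f g \<cdot> h = copair C (f \<cdot> h) (g \<cdot> h)"
  using assms by - (rule bsum_eqI[of "src C f" "src C g"], simp_all)

lemma copair_in [simp]:
  "\<lbrakk>A \<in> Ob C; B \<in> Ob C\<rbrakk> \<Longrightarrow> copair C (in1 C A B) (in2 C A B) = idn C (A \<uplus> B)"
  by (rule bsum_eqI[of A B]) simp_all

lemma copair_in_seq [simp]:
  "\<lbrakk>A \<in> Ob C; B \<in> Ob C; h \<in> Ar C; src C h = A \<uplus> B\<rbrakk>
   \<Longrightarrow> copair C (in1 C A B \<cdot> h) (in2 C A B \<cdot> h) = h"
  by (rule bsum_eqI[of A B]) simp_all

lemma cotuple_eq_copair: "tgt C f = D \<Longrightarrow> cotuple C D [f, g] = copair C f g"
  by (simp add: copair_def)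

lemma codiag_eq [simp]: "A \<in> Ob C \<Longrightarrow> codiag C 2 A = copair C (idn C A) (idn C A)"
  by (simp add: codiag_def cotuple_eq_copair numeral_2_eq_2)

lemma bsum_map_eq [simp]:
  assumes "f \<in> Ar C" "g \<in> Ar C"
  shows "f \<oplus> g = copair C (f \<cdot> in1 C (tgt C f) (tgt C g)) (g \<cdot> in2 C (tgt C f) (tgt C g))"
  using assms by (simp add: csum_map_def cotuple_eq_copair upt_rec One_nat_def)

text \<open>Moving the restriction back across an injection leaves \<open>\<rho> f\<close> or
  \<open>\<rho> g\<close> in front of that injection, and a map out of a coproduct is determined on
  the injections.\<close>

lemma restr_copair:
  assumes [simp]: "f \<in> Ar C" "g \<in> Ar C" "tgt C f = tgt C g"
  shows "\<rho> (copair C f g) = \<rho> f \<oplus> \<rho> g"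
  by (rule bsum_eqI[of "src C f" "src C g"]) (simp_all add: seq_restr_Ar)

lemma restr_bsum_map: "\<lbrakk>f \<in> Ar C; g \<in> Ar C\<rbrakk> \<Longrightarrow> \<rho> (f \<oplus> g) = \<rho> f \<oplus> \<rho> g"
  by (simp add: restr_copair)

end

section \<open>Zero maps and quasi-projections\<close>

context cocartesian_restriction_category_zero
begin

lemma zer_Ar [simp]:
  assumes "A \<in> Ob C" "B \<in> Ob C"
  shows "zer C A B \<in> Ar C" "src C (zer C A B) = A" "tgt C (zer C A B) = B"
  using zer_hom[OF assms] by (auto simp: hom_iff)

lemma seq_zer_Ar [simp]:
    "\<lbrakk>f \<in> Ar C; tgt C f = B; D \<in> Ob C\<rbrakk> \<Longrightarrow> f \<cdot> zer C B D = zer C (src C f) D"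
  and zer_seq_Ar [simp]:
    "\<lbrakk>f \<in> Ar C; src C f = A; D \<in> Ob C\<rbrakk> \<Longrightarrow> zer C D A \<cdot> f = zer C D (tgt C f)"
  using seq_zer zer_seq by (auto simp: hom_iff)

lemma copair_zer [simp]:
  "\<lbrakk>A \<in> Ob C; B \<in> Ob C; D \<in> Ob C\<rbrakk> \<Longrightarrow> copair C (zer C A D) (zer C B D) = zer C (A \<uplus> B) D"
  by (rule bsum_eqI[of A B]) simp_all

lemma qp1_eq [simp]:
  assumes [simp]: "A \<in> Ob C" "B \<in> Ob C"
  shows "qp1 C A B = copair C (idn C A) (zer C B A)"
proof -
  have "(THE p. p \<in> hom C (A \<uplus> B) A \<and> in1 C A B \<cdot> p = idn C A \<and> in2 C A B \<cdot> p = zer C B A) =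
      copair C (idn C A) (zer C B A)"
    by (rule the_equality) (simp add: hom_iff, rule bsum_eqI[of A B], auto simp: hom_iff)
  then show ?thesis by (simp add: qproj_def numeral_2_eq_2[symmetric] all_less_2)
qed

lemma qp2_eq [simp]:
  assumes [simp]: "A \<in> Ob C" "B \<in> Ob C"
  shows "qp2 C A B = copair C (zer C A B) (idn C B)"
proof -
  have "(THE p. p \<in> hom C (A \<uplus> B) B \<and> in1 C A B \<cdot> p = zer C A B \<and> in2 C A B \<cdot> p = idn C B) =
      copair C (zer C A B) (idn C B)"
    by (rule the_equality) (simp add: hom_iff, rule bsum_eqI[of A B], auto simp: hom_iff)
  then show ?thesis by (simp add: qproj_def numeral_2_eq_2[symmetric] all_less_2)
qed

end

section \<open>Components of maps into a coproduct\<close>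

context restriction_category
begin

text \<open>The restriction of one component of \<open>h\<close> is the corresponding component of its decision \<open>d\<close>;
  here \<open>n\<close>, \<open>H\<close> and \<open>m\<close> stand for \<open>\<nabla>\<close>, \<open>h + h\<close> and \<open>\<iota>\<^sub>1 + \<iota>\<^sub>2\<close>.\<close>

lemma restr_component:
  assumes "h \<in> hom C A T" "d \<in> hom C A S" "n \<in> hom C S A" "H \<in> hom C S U"
      "m \<in> hom C T U" "q \<in> hom C S A" "q' \<in> hom C U T" "p \<in> hom C T B" "i \<in> hom C B T"
    and dn: "d \<cdot> n = \<rho> h" and dH: "d \<cdot> H = h \<cdot> m"
    and q: "\<rho> q \<cdot> n = q" and qh: "q \<cdot> h = H \<cdot> q'" and mq': "m \<cdot> q' = p \<cdot> i"
    and i: "total_map C i"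
  shows "d \<cdot> q = \<rho> (h \<cdot> p)"
proof -
  note [simp] = assms(1-9)[unfolded hom_iff]
  have "d \<cdot> q = (d \<cdot> \<rho> q) \<cdot> n" by (simp add: q)
  also have "\<dots> = \<rho> (d \<cdot> q) \<cdot> \<rho> h" by (simp add: seq_restr_Ar[of d q] dn)
  \<comment> \<open>This makes \<open>d \<cdot> q\<close> the restriction of
    \<open>\<rho> (d \<cdot> q) \<cdot> h\<close>. That map turns out to be
    \<open>h \<cdot> p \<cdot> i\<close>, and the total \<open>i\<close> does not change the
    restriction.\<close>
  finally have *: "d \<cdot> q = \<rho> (d \<cdot> q) \<cdot> \<rho> h" .
  have "\<rho> (d \<cdot> q) \<cdot> h = (\<rho> (d \<cdot> q) \<cdot> \<rho> h) \<cdot> h" by simp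
  also have "\<dots> = (d \<cdot> q) \<cdot> h" by (simp only: *[symmetric])
  also have "\<dots> = (d \<cdot> H) \<cdot> q'" by (simp add: qh)
  also have "\<dots> = (h \<cdot> p) \<cdot> i" by (simp add: dH mq')
  finally have "\<rho> (\<rho> (d \<cdot> q) \<cdot> h) = \<rho> (h \<cdot> p)"
    using restr_seq_total[of "h \<cdot> p" i] i by simp
  with * show ?thesis by (simp add: restr_restr_seq_Ar)
qed

end

context extensive_restriction_category
begin

lemma is_dec_of_bsum:
  assumes "h \<in> Ar C"
  shows "is_dec_of C [B, D] h d \<longleftrightarrow> d \<in> hom C (src C h) (src C h \<uplus> src C h) \<and>
    \<rho> h = d \<cdot> codiag C 2 (src C h) \<and> d \<cdot> (h \<oplus> h) = h \<cdot> (in1 C B D \<oplus> in2 C B D)"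
  by (simp add: is_dec_of_def upt_rec numeral_2_eq_2 One_nat_def)

lemma is_dec_of_hom:
  "h \<in> hom C A (B \<uplus> D) \<Longrightarrow> is_dec_of C [B, D] h d \<Longrightarrow> d \<in> hom C A (A \<uplus> A)"
  by (simp add: is_dec_of_bsum hom_iff)

text \<open>Two instances of \<open>restr_component\<close>. They tie every decision of
  \<open>h\<close> to the components of \<open>h\<close> alone, which later yields both uniqueness
  of decisions and disjointness of components.\<close>

lemma dec_of_components:
  assumes [simp]: "B \<in> Ob C" "D \<in> Ob C" and h: "h \<in> hom C A (B \<uplus> D)"
    and d: "is_dec_of C [B, D] h d"
  shows "d \<cdot> qp1 C A A = \<rho> (h \<cdot> qp1 C B D)" "d \<cdot> qp2 C A A = \<rho> (h \<cdot> qp2 C B D)"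
proof -
  note [simp] = h[unfolded hom_iff]
  have [simp]: "A \<in> Ob C" using h by (rule hom_Ob)
  have d': "d \<in> hom C A (A \<uplus> A)" "d \<cdot> codiag C 2 A = \<rho> h"
    "d \<cdot> (h \<oplus> h) = h \<cdot> (in1 C B D \<oplus> in2 C B D)"
    using d by (auto simp: is_dec_of_bsum simp del: codiag_eq bsum_map_eq)
  show "d \<cdot> qp1 C A A = \<rho> (h \<cdot> qp1 C B D)"
    by (rule restr_component[OF h d'(1) _ _ _ _ _ _ _ d'(2,3),
          where q' = "qp1 C (B \<uplus> D) (B \<uplus> D)" and i = "in1 C B D"])
      (simp_all add: hom_iff restr_copair restr_zer in_total)
  show "d \<cdot> qp2 C A A = \<rho> (h \<cdot> qp2 C B D)"
    by (rule restr_component[OF h d'(1) _ _ _ _ _ _ _ d'(2,3),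
          where q' = "qp2 C (B \<uplus> D) (B \<uplus> D)" and i = "in2 C B D"])
      (simp_all add: hom_iff restr_copair restr_zer in_total)
qed

text \<open>The restriction of the first quasi-projection is \<open>1 + 0\<close>, which is also
  that quasi-projection followed by its injection; symmetrically for the second.\<close>

lemma restr_qp_seq:
  assumes [simp]: "B \<in> Ob C" "D \<in> Ob C" and h: "h \<in> hom C A (B \<uplus> D)"
  shows "\<rho> (h \<cdot> qp1 C B D) \<cdot> h = h \<cdot> qp1 C B D \<cdot> in1 C B D"
    "\<rho> (h \<cdot> qp2 C B D) \<cdot> h = h \<cdot> qp2 C B D \<cdot> in2 C B D"
  using h seq_restr_Ar[of h "qp1 C B D"] seq_restr_Ar[of h "qp2 C B D"]
  by (simp_all add: hom_iff restr_copair restr_zer)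

text \<open>The sum \<open>?k\<close> of the two components of \<open>h\<close> satisfies
  \<open>d \<cdot> ?k = h\<close>, so \<open>d \<cdot> \<rho> ?k = \<rho> h \<cdot> d\<close>, and
  \<open>d\<close> has the same restriction as \<open>h\<close>.\<close>

lemma dec_of_restrict:
  assumes [simp]: "B \<in> Ob C" "D \<in> Ob C" and h: "h \<in> hom C A (B \<uplus> D)"
    and d: "is_dec_of C [B, D] h d"
  shows "d \<cdot> (\<rho> (h \<cdot> qp1 C B D) \<oplus> \<rho> (h \<cdot> qp2 C B D)) = d"
proof -
  note [simp] = h[unfolded hom_iff]
  have [simp]: "A \<in> Ob C" using h by (rule hom_Ob)
  have [simp]: "d \<in> Ar C" "src C d = A" "tgt C d = A \<uplus> A" "d \<cdot> copair C (idn C A) (idn C A) = \<rho> h"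
    and dh: "d \<cdot> (h \<oplus> h) = h \<cdot> (in1 C B D \<oplus> in2 C B D)"
    using d by (auto simp: is_dec_of_bsum hom_iff simp del: bsum_map_eq)
  let ?k = "h \<cdot> qp1 C B D \<oplus> h \<cdot> qp2 C B D"
  have k: "?k \<in> Ar C" "src C ?k = A \<uplus> A" by simp_all
  have restr_k: "\<rho> (h \<cdot> qp1 C B D) \<oplus> \<rho> (h \<cdot> qp2 C B D) = \<rho> ?k"
    by (rule restr_bsum_map[symmetric]) simp_all
  have "d \<cdot> ?k = (d \<cdot> (h \<oplus> h)) \<cdot> (qp1 C B D \<oplus> qp2 C B D)" by simp
  also have "\<dots> = h" by (simp only: dh) simp
  finally have dk: "d \<cdot> ?k = h" .
  \<comment> \<open>The codiagonal is total, so composing with it keeps the restriction of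
    \<open>d\<close>.\<close>
  have "\<rho> d = \<rho> (d \<cdot> copair C (idn C A) (idn C A))"
    by (rule restr_seq_total[symmetric]) (simp_all add: total_map_def restr_copair)
  then have "\<rho> d = \<rho> h" by simp
  then have "\<rho> h \<cdot> d = d" using restr_seq_Ar[of d] by simp
  then show ?thesis
    using seq_restr_Ar[of d ?k] unfolding restr_k dk by (simp add: k)
qed

text \<open>By antisymmetry one inequality suffices. A decision of \<open>h\<close> splits
  \<open>\<rho> h \<cdot> k\<close> into the pieces \<open>?e1 \<cdot> k\<close> and
  \<open>?e2 \<cdot> k\<close>; for \<open>k = h\<close> and \<open>k = h'\<close> these pieces
  depend only on the common components.\<close>

lemma qp_jointly_monic:
  assumes [simp]: "B \<in> Ob C" "D \<in> Ob C" and h: "h \<in> hom C A (B \<uplus> D)"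
    and h': "h' \<in> hom C A (B \<uplus> D)"
    and "h \<cdot> qp1 C B D = h' \<cdot> qp1 C B D" "h \<cdot> qp2 C B D = h' \<cdot> qp2 C B D"
  shows "h = h'"
proof -
  have le: "\<rho> h \<cdot> h' = h"
    if h: "h \<in> hom C A (B \<uplus> D)" and h': "h' \<in> hom C A (B \<uplus> D)"
      and eq: "h \<cdot> qp1 C B D = h' \<cdot> qp1 C B D" "h \<cdot> qp2 C B D = h' \<cdot> qp2 C B D" for h h'
  proof -
    have [simp]: "A \<in> Ob C" using h by (rule hom_Ob)
    note [simp] = h[unfolded hom_iff] h'[unfolded hom_iff]
    obtain d where d: "is_dec_of C [B, D] h d" using dec_exists[of "[B, D]" h A] h by auto
    have [simp]: "d \<in> Ar C" "src C d = A" "tgt C d = A \<uplus> A" and dn: "d \<cdot> codiag C 2 A = \<rho> h"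
      using d by (auto simp: is_dec_of_bsum hom_iff simp del: bsum_map_eq)
    let ?e1 = "\<rho> (h \<cdot> qp1 C B D)" and ?e2 = "\<rho> (h \<cdot> qp2 C B D)"
    have e: "?e1 \<cdot> h = ?e1 \<cdot> h'" "?e2 \<cdot> h = ?e2 \<cdot> h'"
      using restr_qp_seq[OF _ _ h] restr_qp_seq[OF _ _ h'] eq
      by (simp_all del: qp1_eq qp2_eq)
    have h_eq: "\<rho> h \<cdot> k = d \<cdot> copair C (?e1 \<cdot> k) (?e2 \<cdot> k)" if [simp]: "k \<in> hom C A (B \<uplus> D)" for k
    proof -
      note [simp] = that[unfolded hom_iff]
      \<comment> \<open>Write \<open>\<rho> h\<close> as \<open>d\<close> followed by \<nabla>, then
        insert the restrictions of the components behind \<open>d\<close>.\<close>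
      have "\<rho> h \<cdot> k = (d \<cdot> (?e1 \<oplus> ?e2)) \<cdot> copair C k k"
        unfolding dec_of_restrict[OF _ _ h d, simplified] dn[symmetric]
        by (simp add: dec_of_restrict[OF _ _ h d, simplified])
      then show ?thesis by simp
    qed
    show "\<rho> h \<cdot> h' = h" using h_eq[OF h] h_eq[OF h'] e by simp
  qed
  show ?thesis
    by (rule restriction_order_antisym) (use le[OF h h'] le[OF h' h] assms in \<open>auto simp: hom_iff\<close>)
qed

text \<open>Any two decisions of \<open>h\<close> have the same components, so the definite
  description in \<open>dec_of\<close> is well defined.\<close>

lemma dec_of_eq:
  assumes [simp]: "B \<in> Ob C" "D \<in> Ob C" and h: "h \<in> hom C A (B \<uplus> D)"
    and d: "is_dec_of C [B, D] h d"
  shows "dec_of C [B, D] h = d"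
  unfolding dec_of_def
proof (rule the_equality)
  fix d' assume d': "is_dec_of C [B, D] h d'"
  have A: "A \<in> Ob C" using h by (rule hom_Ob)
  show "d' = d"
    by (rule qp_jointly_monic[OF A A is_dec_of_hom[OF h d'] is_dec_of_hom[OF h d]])
      (simp_all only: dec_of_components[OF assms(1,2) h d] dec_of_components[OF assms(1,2) h d'])
qed (rule d)

text \<open>If the components of \<open>d\<close> are restriction idempotents, those of its decision
  are their restrictions, hence the same idempotents; joint monicity then identifies
  \<open>d\<close> with its decision.\<close>

lemma is_dec2_iff:
  assumes [simp]: "f \<in> Ar C" "g \<in> Ar C" "src C f = A" "src C g = A"
  shows "is_dec2 C f g d \<longleftrightarrow>
    d \<in> hom C A (A \<uplus> A) \<and> d \<cdot> qp1 C A A = \<rho> f \<and> d \<cdot> qp2 C A A = \<rho> g" (is "_ \<longleftrightarrow> ?R")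
proof
  assume "is_dec2 C f g d"
  then show ?R by (auto simp: is_dec2_def decision_def numeral_2_eq_2)
next
  assume R: ?R
  have [simp]: "A \<in> Ob C" using src_Ob[of f] by simp
  obtain d' where d': "is_dec_of C [A, A] d d'"
    using dec_exists[of "[A, A]" d A] R by auto
  have d: "d \<in> hom C A (A \<uplus> A)" using R by simp
  have "d' = d"
    by (rule qp_jointly_monic[OF _ _ is_dec_of_hom[OF d d'] d])
      (use dec_of_components[OF _ _ d d'] R in simp_all)
  then show "is_dec2 C f g d"
    using dec_of_eq[OF _ _ d d'] R by (auto simp: is_dec2_def decision_def numeral_2_eq_2)
qed

lemma dec2_props:
  assumes "f \<bottom> g" "src C f = A"
  shows "dec2 C f g \<in> hom C A (A \<uplus> A)" "dec2 C f g \<cdot> qp1 C A A = \<rho> f"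
    "dec2 C f g \<cdot> qp2 C A A = \<rho> g"
proof -
  have [simp]: "f \<in> Ar C" "g \<in> Ar C" "src C f = A" "src C g = A" "A \<in> Ob C"
    using assms by (auto simp: perp_def)
  obtain d where d: "is_dec2 C f g d" using assms by (auto simp: perp_def)
  have "dec2 C f g = d"
    unfolding dec2_def
    by (rule the_equality, rule d, rule qp_jointly_monic[of A A _ A])
      (use d in \<open>auto simp: is_dec2_iff\<close>)
  with d show "dec2 C f g \<in> hom C A (A \<uplus> A)" "dec2 C f g \<cdot> qp1 C A A = \<rho> f"
    "dec2 C f g \<cdot> qp2 C A A = \<rho> g" by (auto simp: is_dec2_iff)
qed

text \<open>The components of the decision are \<open>\<rho> f\<close> and \<open>\<rho> g\<close>,
  which are absorbed by the \<open>f\<close> and \<open>g\<close> that follow.\<close>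

lemma row_props:
  assumes "f \<in> hom C A B" "g \<in> hom C A D" "f \<bottom> g"
  shows "row C f g \<in> hom C A (B \<uplus> D)" "row C f g \<cdot> qp1 C B D = f" "row C f g \<cdot> qp2 C B D = g"
proof -
  have [simp]: "A \<in> Ob C" "B \<in> Ob C" "D \<in> Ob C" using assms hom_Ob by blast+
  note [simp] = assms(1,2)[unfolded hom_iff] dec2_props(1)[OF assms(3), of A, unfolded hom_iff]
  show "row C f g \<in> hom C A (B \<uplus> D)" by (simp add: row_def hom_iff)
  have "row C f g \<cdot> qp1 C B D = (dec2 C f g \<cdot> qp1 C A A) \<cdot> f"
    "row C f g \<cdot> qp2 C B D = (dec2 C f g \<cdot> qp2 C A A) \<cdot> g" by (simp_all add: row_def)
  with dec2_props(2,3)[OF assms(3), of A]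
  show "row C f g \<cdot> qp1 C B D = f" "row C f g \<cdot> qp2 C B D = g"
    by (simp_all del: qp1_eq qp2_eq)
qed

lemma components_hom:
  assumes "B \<in> Ob C" "D \<in> Ob C" "h \<in> hom C A (B \<uplus> D)"
  shows "h \<cdot> qp1 C B D \<in> hom C A B" "h \<cdot> qp2 C B D \<in> hom C A D"
  using assms by (simp_all add: hom_iff)

text \<open>A decision of \<open>h\<close> itself witnesses the disjointness.\<close>

lemma components_perp:
  assumes [simp]: "B \<in> Ob C" "D \<in> Ob C" and h: "h \<in> hom C A (B \<uplus> D)"
  shows "h \<cdot> qp1 C B D \<bottom> h \<cdot> qp2 C B D"
proof -
  note [simp] = h[unfolded hom_iff]
  obtain d where d: "is_dec_of C [B, D] h d" using dec_exists[of "[B, D]" h A] h by auto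
  then have "is_dec2 C (h \<cdot> qp1 C B D) (h \<cdot> qp2 C B D) d"
    using dec_of_components[OF _ _ h d] by (subst is_dec2_iff) (auto simp: is_dec_of_bsum hom_iff)
  then show ?thesis by (auto simp: perp_def)
qed

text \<open>Both sides have the same components. Together with \<open>row_props\<close> this is the
  bijection between maps into \<open>B + D\<close> and disjoint pairs.\<close>

lemma row_components:
  assumes [simp]: "B \<in> Ob C" "D \<in> Ob C" and h: "h \<in> hom C A (B \<uplus> D)"
  shows "row C (h \<cdot> qp1 C B D) (h \<cdot> qp2 C B D) = h"
  using row_props[OF components_hom[OF _ _ h] components_perp[OF _ _ h]]
  by - (rule qp_jointly_monic[OF _ _ _ h], simp_all)

text \<open>A join is a row followed by the codiagonal, and the row of the components is
  \<open>h\<close>.\<close>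

lemma join_components:
  assumes [simp]: "B \<in> Ob C" and h: "h \<in> hom C A (B \<uplus> B)"
  shows "h \<cdot> qp1 C B B \<squnion> h \<cdot> qp2 C B B = h \<cdot> codiag C 2 B"
proof -
  have "tgt C (h \<cdot> qp1 C B B) = B" using h by (simp add: hom_iff)
  then show ?thesis using row_components[OF assms(1,1) h] by (simp only: join_def row_def)
qed

text \<open>This translates the copairing in the iteration equation and in the trace formula into
  the join used by the wand.\<close>

lemma seq_copair_idn_eq_join:
  assumes [simp]: "B \<in> Ob C" and h: "h \<in> hom C A (B \<uplus> D)" and w: "w \<in> hom C B D"
  shows "h \<cdot> qp2 C B D \<bottom> h \<cdot> qp1 C B D \<cdot> w"
    and "h \<cdot> copair C w (idn C D) = h \<cdot> qp2 C B D \<squnion> h \<cdot> qp1 C B D \<cdot> w"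
proof -
  have [simp]: "D \<in> Ob C" using w by (rule hom_Ob)
  note [simp] = h[unfolded hom_iff] w[unfolded hom_iff]
  \<comment> \<open>The two summands are swapped so that the exit component comes first, as in the
    wand axiom.\<close>
  define k where "k = h \<cdot> copair C (w \<cdot> in2 C D D) (in1 C D D)"
  have k: "k \<in> hom C A (D \<uplus> D)" "k \<cdot> qp1 C D D = h \<cdot> qp2 C B D"
    "k \<cdot> qp2 C D D = h \<cdot> qp1 C B D \<cdot> w" "k \<cdot> codiag C 2 D = h \<cdot> copair C w (idn C D)"
    by (simp_all add: k_def hom_iff)
  show "h \<cdot> qp2 C B D \<bottom> h \<cdot> qp1 C B D \<cdot> w"
    using components_perp[OF _ _ k(1)] unfolding k by simp
  show "h \<cdot> copair C w (idn C D) = h \<cdot> qp2 C B D \<squnion> h \<cdot> qp1 C B D \<cdot> w"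
    using join_components[OF _ k(1)] unfolding k by simp
qed

end

section \<open>The trace of an iteration operator\<close>

locale iteration_category =
  cocartesian_restriction_category C + parametrized_iteration_operator C Iter
  for C :: "('o, 'm, 'z) crcat_scheme" (structure) and Iter
begin

lemma Iter_Ar [simp]:
  assumes "X \<in> Ob C" "A \<in> Ob C" "f \<in> Ar C" "src C f = X" "tgt C f = X \<uplus> A"
  shows "Iter X A f \<in> Ar C" "src C (Iter X A f) = X" "tgt C (Iter X A f) = A"
  using Iter_hom[of X A f] assms by (auto simp: hom_iff)

text \<open>
  Bekic's identity. The loop on \<open>X + Y\<close> is the diagonal of a double loop in which jumps to \<open>X\<close>
  stay in the inner loop and jumps to \<open>Y\<close> leave it; dinaturality along the two injections
  then shrinks the inner loop to \<open>X\<close> and the outer loop to \<open>Y\<close>.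
\<close>

lemma Iter_bsum:
  fixes F X Y B
  defines "Ft \<equiv> F \<cdot> assoc_r C X Y B"
  defines "P \<equiv> Iter X (Y \<uplus> B) (in1 C X Y \<cdot> Ft)"
  defines "s \<equiv> Iter Y B (in2 C X Y \<cdot> Ft \<cdot> copair C P (idn C (Y \<uplus> B)))"
  assumes [simp]: "X \<in> Ob C" "Y \<in> Ob C" "B \<in> Ob C"
    and F: "F \<in> hom C (X \<uplus> Y) ((X \<uplus> Y) \<uplus> B)"
  shows "Iter (X \<uplus> Y) B F = copair C (P \<cdot> copair C s (idn C B)) s"
proof -
  note [simp] = F[unfolded hom_iff]
  have [simp]: "Ft \<in> Ar C" "src C Ft = X \<uplus> Y" "tgt C Ft = X \<uplus> (Y \<uplus> B)"
    by (simp_all add: Ft_def assoc_r_def)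
  have [simp]: "P \<in> Ar C" "src C P = X" "tgt C P = Y \<uplus> B" by (simp_all add: P_def)
  have [simp]: "s \<in> Ar C" "src C s = Y" "tgt C s = B" by (simp_all add: s_def)
  define j where "j = in2 C X Y \<oplus> idn C B"
  have [simp]: "j \<in> Ar C" "src C j = Y \<uplus> B" "tgt C j = (X \<uplus> Y) \<uplus> B" by (simp_all add: j_def)
  \<comment> \<open>Jumps to \<open>Y\<close> are redirected into a second copy of
    \<open>X + Y\<close>, where they count as exits from the inner loop.\<close>
  define f where "f = Ft \<cdot> (idn C X \<oplus> j)"
  have [simp]: "f \<in> Ar C" "src C f = X \<uplus> Y" "tgt C f = X \<uplus> ((X \<uplus> Y) \<uplus> B)"
    by (simp_all add: f_def)
  define G where "G = f \<cdot> (in1 C X Y \<oplus> idn C ((X \<uplus> Y) \<uplus> B))"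
  have [simp]: "G \<in> Ar C" "src C G = X \<uplus> Y" "tgt C G = (X \<uplus> Y) \<uplus> ((X \<uplus> Y) \<uplus> B)"
    by (simp_all add: G_def)
  define H where "H = Ft \<cdot> copair C P (idn C (Y \<uplus> B))"
  have [simp]: "H \<in> Ar C" "src C H = X \<uplus> Y" "tgt C H = Y \<uplus> B" by (simp_all add: H_def)
  let ?G = "Iter (X \<uplus> Y) ((X \<uplus> Y) \<uplus> B) G" and ?F = "Iter (X \<uplus> Y) B F"
  have "in1 C X Y \<cdot> ?G = Iter X ((X \<uplus> Y) \<uplus> B) (in1 C X Y \<cdot> f)"
    unfolding G_def by (rule Iter_dinatural[symmetric]) (simp_all add: hom_iff)
  also have "in1 C X Y \<cdot> f = in1 C X Y \<cdot> Ft \<cdot> (idn C X \<oplus> j)" by (simp add: f_def)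
  also have "Iter X ((X \<uplus> Y) \<uplus> B) \<dots> = P \<cdot> j"
    unfolding P_def by (rule Iter_natural) (simp_all add: hom_iff)
  finally have inner: "in1 C X Y \<cdot> ?G = P \<cdot> j" .
  have "?G = G \<cdot> copair C ?G (idn C ((X \<uplus> Y) \<uplus> B))"
    by (rule Iter_iteration[symmetric]) (simp_all add: hom_iff)
  \<comment> \<open>In \<open>G\<close> the inner loop is re-entered only at \<open>X\<close>, so
    only the restriction of \<open>?G\<close> along the first injection matters.\<close>
  also have "\<dots> = f \<cdot> copair C (in1 C X Y \<cdot> ?G) (idn C ((X \<uplus> Y) \<uplus> B))"
    by (simp add: G_def)
  also have "\<dots> = H \<cdot> j" unfolding inner by (simp add: f_def H_def)
  finally have G: "?G = H \<cdot> j" .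
  \<comment> \<open>Merging the two copies of \<open>X + Y\<close> forgets which loop a jump belongs
    to and gives back \<open>F\<close>.\<close>
  have "G \<cdot> assoc_l C (X \<uplus> Y) (X \<uplus> Y) B \<cdot> (codiag C 2 (X \<uplus> Y) \<oplus> idn C B) = F"
    by (simp add: G_def f_def j_def Ft_def assoc_l_def assoc_r_def)
  with Iter_diagonal[of "X \<uplus> Y" B G] G have outer: "?F = Iter (X \<uplus> Y) B (H \<cdot> j)"
    by (simp add: hom_iff)
  \<comment> \<open>The outer loop is re-entered only through \<open>in2\<close>, so it shrinks to a
    loop on \<open>Y\<close>.\<close>
  have "in2 C X Y \<cdot> Iter (X \<uplus> Y) B (H \<cdot> j) = Iter Y B (in2 C X Y \<cdot> H)"
    unfolding j_def by (rule Iter_dinatural[symmetric]) (simp_all add: hom_iff)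
  also have "\<dots> = s" by (simp add: s_def H_def)
  finally have F2: "in2 C X Y \<cdot> ?F = s" by (simp add: outer)
  have "?F = H \<cdot> j \<cdot> copair C ?F (idn C B)"
    unfolding outer by (rule Iter_iteration[symmetric]) (simp_all add: hom_iff)
  also have "\<dots> = H \<cdot> copair C (in2 C X Y \<cdot> ?F) (idn C B)" by (simp add: j_def)
  finally have F: "?F = H \<cdot> copair C s (idn C B)" unfolding F2 .
  have "in1 C X Y \<cdot> ?F = (in1 C X Y \<cdot> Ft \<cdot> copair C P (idn C (Y \<uplus> B))) \<cdot> copair C s (idn C B)"
    by (simp add: F H_def)
  also have "in1 C X Y \<cdot> Ft \<cdot> copair C P (idn C (Y \<uplus> B)) = P"
    unfolding P_def by (rule Iter_iteration) (simp_all add: hom_iff)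
  finally show ?thesis
    using F2 by - (rule bsum_eqI[of X Y], simp_all)
qed

text \<open>Tightening and superposing come from naturality, sliding from dinaturality, vanishing
  from \<open>Iter_bsum\<close>, and yanking from a single unfolding of the loop.\<close>

lemma iter_trace_operator: "trace_operator C (iter_trace C Iter)"
proof
  fix X A B f
  assume "X \<in> Ob C" "A \<in> Ob C" "B \<in> Ob C" "f \<in> hom C (X \<uplus> A) (X \<uplus> B)"
  then show "iter_trace C Iter X A B f \<in> hom C A B" by (simp add: iter_trace_def hom_iff)
next
  fix X A A' B B' f g h
  assume [simp]: "X \<in> Ob C" "A \<in> Ob C" "A' \<in> Ob C" "B \<in> Ob C" "B' \<in> Ob C"
    and "f \<in> hom C (X \<uplus> A) (X \<uplus> B)" "g \<in> hom C A' A" "h \<in> hom C B B'"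
  note [simp] = this(6-8)[unfolded hom_iff]
  have "in1 C X A' \<cdot> ((idn C X \<oplus> g) \<cdot> f \<cdot> (idn C X \<oplus> h)) = in1 C X A \<cdot> f \<cdot> (idn C X \<oplus> h)"
    by simp
  then have "Iter X B' (in1 C X A' \<cdot> ((idn C X \<oplus> g) \<cdot> f \<cdot> (idn C X \<oplus> h))) =
      Iter X B (in1 C X A \<cdot> f) \<cdot> h"
    using Iter_natural[of X B' B "in1 C X A \<cdot> f" h] by (simp add: hom_iff)
  then show "iter_trace C Iter X A' B' ((idn C X \<oplus> g) \<cdot> f \<cdot> (idn C X \<oplus> h)) =
      g \<cdot> iter_trace C Iter X A B f \<cdot> h"
    by (simp add: iter_trace_def)
next
  fix X X' A B f k
  assume [simp]: "X \<in> Ob C" "X' \<in> Ob C" "A \<in> Ob C" "B \<in> Ob C"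
    and "f \<in> hom C (X \<uplus> A) (X' \<uplus> B)" "k \<in> hom C X' X"
  note [simp] = this(5,6)[unfolded hom_iff]
  have "Iter X' B (k \<cdot> (in1 C X A \<cdot> f)) = k \<cdot> Iter X B (in1 C X A \<cdot> f \<cdot> (k \<oplus> idn C B))"
    by (rule Iter_dinatural) (simp_all add: hom_iff)
  then show "iter_trace C Iter X A B (f \<cdot> (k \<oplus> idn C B)) =
      iter_trace C Iter X' A B ((k \<oplus> idn C A) \<cdot> f)"
    by (simp add: iter_trace_def)
next
  fix X Y A B f
  assume [simp]: "X \<in> Ob C" "Y \<in> Ob C" "A \<in> Ob C" "B \<in> Ob C"
    and "f \<in> hom C ((X \<uplus> Y) \<uplus> A) ((X \<uplus> Y) \<uplus> B)"
  note [simp] = this(5)[unfolded hom_iff]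
  define F where "F = in1 C (X \<uplus> Y) A \<cdot> f"
  define P where "P = Iter X (Y \<uplus> B) (in1 C X Y \<cdot> (F \<cdot> assoc_r C X Y B))"
  define s where
    "s = Iter Y B (in2 C X Y \<cdot> (F \<cdot> assoc_r C X Y B) \<cdot> copair C P (idn C (Y \<uplus> B)))"
  \<comment> \<open>The inner trace over \<open>X\<close>. Its own loop on \<open>Y\<close> is the
    \<open>s\<close> of Bekic's identity.\<close>
  define t where "t = in2 C X (Y \<uplus> A) \<cdot> (assoc_l C X Y A \<cdot> f \<cdot> assoc_r C X Y B) \<cdot>
    copair C P (idn C (Y \<uplus> B))"
  have [simp]: "F \<in> Ar C" "src C F = X \<uplus> Y" "tgt C F = (X \<uplus> Y) \<uplus> B" by (simp_all add: F_def)
  have [simp]: "P \<in> Ar C" "src C P = X" "tgt C P = Y \<uplus> B" by (simp_all add: P_def assoc_r_def)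
  have [simp]: "s \<in> Ar C" "src C s = Y" "tgt C s = B" by (simp_all add: s_def assoc_r_def)
  have [simp]: "t \<in> Ar C" "src C t = Y \<uplus> A" "tgt C t = Y \<uplus> B"
    by (simp_all add: t_def assoc_l_def assoc_r_def)
  have "in1 C X (Y \<uplus> A) \<cdot> (assoc_l C X Y A \<cdot> f \<cdot> assoc_r C X Y B) =
      in1 C X Y \<cdot> (F \<cdot> assoc_r C X Y B)"
    by (simp add: F_def assoc_l_def assoc_r_def)
  then have t: "iter_trace C Iter X (Y \<uplus> A) (Y \<uplus> B) (assoc_l C X Y A \<cdot> f \<cdot> assoc_r C X Y B) = t"
    by (simp only: iter_trace_def t_def P_def)
  have "in1 C Y A \<cdot> t = in2 C X Y \<cdot> (F \<cdot> assoc_r C X Y B) \<cdot> copair C P (idn C (Y \<uplus> B))"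
    by (simp add: t_def F_def assoc_l_def assoc_r_def)
  then have s: "Iter Y B (in1 C Y A \<cdot> t) = s" by (simp only: s_def)
  have "Iter (X \<uplus> Y) B F = copair C (P \<cdot> copair C s (idn C B)) s"
    unfolding P_def s_def by (rule Iter_bsum) (simp_all add: hom_iff)
  then have "iter_trace C Iter (X \<uplus> Y) A B f =
      in2 C (X \<uplus> Y) A \<cdot> f \<cdot> copair C (copair C (P \<cdot> copair C s (idn C B)) s) (idn C B)"
    by (simp add: iter_trace_def F_def)
  also have "\<dots> = in2 C Y A \<cdot> t \<cdot> copair C s (idn C B)"
    by (simp add: t_def assoc_l_def assoc_r_def)
  finally show "iter_trace C Iter (X \<uplus> Y) A B f = iter_trace C Iter Y A B
      (iter_trace C Iter X (Y \<uplus> A) (Y \<uplus> B) (assoc_l C X Y A \<cdot> f \<cdot> assoc_r C X Y B))"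
    unfolding t by (simp only: iter_trace_def s)
next
  fix X A B D E f g
  assume [simp]: "X \<in> Ob C" "A \<in> Ob C" "B \<in> Ob C" "D \<in> Ob C" "E \<in> Ob C"
    and "f \<in> hom C (X \<uplus> A) (X \<uplus> B)" "g \<in> hom C D E"
  note [simp] = this(6,7)[unfolded hom_iff]
  let ?f = "assoc_l C X A D \<cdot> (f \<oplus> g) \<cdot> assoc_r C X B E"
  have "in1 C X (A \<uplus> D) \<cdot> ?f = in1 C X A \<cdot> f \<cdot> (idn C X \<oplus> in1 C B E)"
    by (simp add: assoc_l_def assoc_r_def)
  then have "Iter X (B \<uplus> E) (in1 C X (A \<uplus> D) \<cdot> ?f) = Iter X B (in1 C X A \<cdot> f) \<cdot> in1 C B E"
    using Iter_natural[of X "B \<uplus> E" B "in1 C X A \<cdot> f" "in1 C B E"]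
    by (simp add: hom_iff del: bsum_map_eq)
  then show "iter_trace C Iter X (A \<uplus> D) (B \<uplus> E) ?f = iter_trace C Iter X A B f \<oplus> g"
    unfolding iter_trace_def
    by (simp only:) (simp add: assoc_l_def assoc_r_def)
next
  fix X assume [simp]: "X \<in> Ob C"
  have "Iter X X (in2 C X X) = idn C X"
    using Iter_iteration[of X X "in2 C X X"] by (simp add: hom_iff)
  then show "iter_trace C Iter X X X (symm C X X) = idn C X"
    by (simp add: iter_trace_def symm_def)
qed

text \<open>Along \<open>in1\<close> the hypothesis is the uniformity square for the loop maps;
  along \<open>in2\<close> the factor \<open>h + 1\<close> disappears.\<close>

lemma uniform_iter_trace:
  assumes "uniform_iteration C Iter"
  shows "uniform_trace C (iter_trace C Iter)"
  unfolding uniform_trace_def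
proof (intro ballI impI)
  fix X Y A B f f' h
  assume [simp]: "X \<in> Ob C" "Y \<in> Ob C" "A \<in> Ob C" "B \<in> Ob C"
    and "f \<in> hom C (X \<uplus> A) (X \<uplus> B)" "f' \<in> hom C (Y \<uplus> A) (Y \<uplus> B)" "h \<in> hom C X Y"
    and eq: "f \<cdot> (h \<oplus> idn C B) = (h \<oplus> idn C A) \<cdot> f'"
  note [simp] = this(5-7)[unfolded hom_iff]
  have "in1 C X A \<cdot> f \<cdot> (h \<oplus> idn C B) = in1 C X A \<cdot> ((h \<oplus> idn C A) \<cdot> f')"
    unfolding eq[symmetric] by simp
  then have "in1 C X A \<cdot> f \<cdot> (h \<oplus> idn C B) = h \<cdot> (in1 C Y A \<cdot> f')" by simp
  then have *: "Iter X B (in1 C X A \<cdot> f) = h \<cdot> Iter Y B (in1 C Y A \<cdot> f')"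
    using assms unfolding uniform_iteration_def by (simp add: hom_iff)
  let ?w = "Iter Y B (in1 C Y A \<cdot> f')"
  have "iter_trace C Iter X A B f = in2 C X A \<cdot> (f \<cdot> (h \<oplus> idn C B)) \<cdot> copair C ?w (idn C B)"
    by (simp add: iter_trace_def *)
  also have "\<dots> = iter_trace C Iter Y A B f'"
    unfolding eq by (simp add: iter_trace_def)
  finally show "iter_trace C Iter X A B f = iter_trace C Iter Y A B f'" .
qed

end

section \<open>The iteration operator of a Kleene wand\<close>

locale itegory = extensive_restriction_category C + kleene_wand C wand
  for C :: "('o, 'm, 'z) crcat_scheme" (structure)
    and wand :: "'m \<Rightarrow> 'm \<Rightarrow> 'm"  (infixl \<open>\<star>\<close> 70)
begin

text \<open>The quasi-projections recover the pair from its row, so the definite description has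
  only one candidate.\<close>

lemma wand_iter_row:
  assumes f: "f\<^sub>1 \<in> hom C X X" "f\<^sub>2 \<in> hom C X A" "f\<^sub>1 \<bottom> f\<^sub>2"
  shows "wand_iter C (\<star>) X A (row C f\<^sub>1 f\<^sub>2) = f\<^sub>1 \<star> f\<^sub>2"
  unfolding wand_iter_def
proof (rule the_equality)
  show "\<exists>g\<^sub>1\<in>hom C X X. \<exists>g\<^sub>2\<in>hom C X A. g\<^sub>1 \<bottom> g\<^sub>2 \<and> row C f\<^sub>1 f\<^sub>2 = row C g\<^sub>1 g\<^sub>2 \<and> f\<^sub>1 \<star> f\<^sub>2 = g\<^sub>1 \<star> g\<^sub>2"
    using f by blast
next
  fix m assume "\<exists>g\<^sub>1\<in>hom C X X. \<exists>g\<^sub>2\<in>hom C X A. g\<^sub>1 \<bottom> g\<^sub>2 \<and> row C f\<^sub>1 f\<^sub>2 = row C g\<^sub>1 g\<^sub>2 \<and> m = g\<^sub>1 \<star> g\<^sub>2"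
  then show "m = f\<^sub>1 \<star> f\<^sub>2" using row_props(2,3)[OF f] row_props(2,3) by metis
qed

lemma wand_iter_eq:
  assumes "X \<in> Ob C" "A \<in> Ob C" "h \<in> hom C X (X \<uplus> A)"
  shows "wand_iter C (\<star>) X A h = (h \<cdot> qp1 C X A) \<star> (h \<cdot> qp2 C X A)"
  using wand_iter_row[OF components_hom components_perp, OF assms assms assms]
  unfolding row_components[OF assms] .

lemma wand_iter_hom:
  assumes "X \<in> Ob C" "A \<in> Ob C" "h \<in> hom C X (X \<uplus> A)"
  shows "wand_iter C (\<star>) X A h \<in> hom C X A"
  unfolding wand_iter_eq[OF assms] by (rule wand_hom[OF components_hom components_perp]) fact+

text \<open>Composing with \<open>1 + h\<close> changes only the exit component, and with
  \<open>k + 1\<close> only the loop component, so naturality and dinaturality match the wand axioms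
  directly.\<close>

lemma wand_iter_operator: "parametrized_iteration_operator C (wand_iter C (\<star>))"
proof
  fix X A f
  assume f: "X \<in> Ob C" "A \<in> Ob C" "f \<in> hom C X (X \<uplus> A)"
  then show "wand_iter C (\<star>) X A f \<in> hom C X A" by (rule wand_iter_hom)
  show "f \<cdot> copair C (wand_iter C (\<star>) X A f) (idn C A) = wand_iter C (\<star>) X A f"
    unfolding seq_copair_idn_eq_join(2)[OF f(1,3) wand_iter_hom[OF f]] unfolding wand_iter_eq[OF f]
    by (rule wand_iteration[OF components_hom components_perp]) fact+
next
  fix X A A' f h
  assume [simp]: "X \<in> Ob C" "A \<in> Ob C" "A' \<in> Ob C"
    and f: "f \<in> hom C X (X \<uplus> A')" and h: "h \<in> hom C A' A"
  note [simp] = f[unfolded hom_iff] h[unfolded hom_iff]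
  have "wand_iter C (\<star>) X A (f \<cdot> (idn C X \<oplus> h)) = (f \<cdot> qp1 C X A') \<star> (f \<cdot> qp2 C X A' \<cdot> h)"
    by (subst wand_iter_eq) (simp_all add: hom_iff)
  also have "\<dots> = wand_iter C (\<star>) X A' f \<cdot> h"
    unfolding wand_iter_eq[OF \<open>X \<in> Ob C\<close> \<open>A' \<in> Ob C\<close> f]
    by (rule wand_natural[symmetric, OF components_hom _ components_perp]) fact+
  finally show "wand_iter C (\<star>) X A (f \<cdot> (idn C X \<oplus> h)) = wand_iter C (\<star>) X A' f \<cdot> h" .
next
  fix X X' A f k
  assume [simp]: "X \<in> Ob C" "X' \<in> Ob C" "A \<in> Ob C"
    and f: "f \<in> hom C X' (X \<uplus> A)" and k: "k \<in> hom C X X'"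
  note [simp] = f[unfolded hom_iff] k[unfolded hom_iff]
  have "wand_iter C (\<star>) X A (k \<cdot> f) = (k \<cdot> (f \<cdot> qp1 C X A)) \<star> (k \<cdot> (f \<cdot> qp2 C X A))"
    by (subst wand_iter_eq) (simp_all add: hom_iff)
  also have "\<dots> = k \<cdot> ((f \<cdot> qp1 C X A \<cdot> k) \<star> (f \<cdot> qp2 C X A))"
    by (rule wand_dinatural[OF components_hom _ components_perp]) fact+
  also have "(f \<cdot> qp1 C X A \<cdot> k) \<star> (f \<cdot> qp2 C X A) = wand_iter C (\<star>) X' A (f \<cdot> (k \<oplus> idn C A))"
    by (subst wand_iter_eq) (simp_all add: hom_iff)
  finally show "wand_iter C (\<star>) X A (k \<cdot> f) = k \<cdot> wand_iter C (\<star>) X' A (f \<cdot> (k \<oplus> idn C A))" .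
next
  fix X A f
  assume [simp]: "X \<in> Ob C" "A \<in> Ob C" and f: "f \<in> hom C X (X \<uplus> (X \<uplus> A))"
  note [simp] = f[unfolded hom_iff]
  \<comment> \<open>Here \<open>f\<close> is \<open>[a [b c]]\<close> with \<open>r = [b c]\<close>.
    The nested loops should become \<open>a \<star> b\<close> with exit \<open>a \<star> c\<close>,
    and the merged loop \<open>g\<close> should be \<open>[a \<squnion> b c]\<close>.\<close>
  define a where "a = f \<cdot> qp1 C X (X \<uplus> A)"
  define r where "r = f \<cdot> qp2 C X (X \<uplus> A)"
  define b where "b = r \<cdot> qp1 C X A"
  define c where "c = r \<cdot> qp2 C X A"
  define k where "k = f \<cdot> assoc_l C X X A"
  define g where "g = k \<cdot> (codiag C 2 X \<oplus> idn C A)"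
  have typing: "a \<in> hom C X X" "r \<in> hom C X (X \<uplus> A)" "b \<in> hom C X X" "c \<in> hom C X A"
    "k \<in> hom C X ((X \<uplus> X) \<uplus> A)" "g \<in> hom C X (X \<uplus> A)"
    by (simp_all add: a_def r_def b_def c_def k_def g_def assoc_l_def hom_iff)
  have ar: "a \<bottom> r" unfolding a_def r_def using f by (intro components_perp) simp_all
  \<comment> \<open>After reassociation the first component is the row \<open>[a b]\<close>, whose
    codiagonal is the join of \<open>a\<close> and \<open>b\<close>.\<close>
  have k1: "k \<cdot> qp1 C (X \<uplus> X) A \<in> hom C X (X \<uplus> X)"
    "k \<cdot> qp1 C (X \<uplus> X) A \<cdot> qp1 C X X = a" "k \<cdot> qp1 C (X \<uplus> X) A \<cdot> qp2 C X X = b"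
    by (simp_all add: a_def r_def b_def k_def assoc_l_def hom_iff)
  have ab: "a \<bottom> b" using components_perp[OF _ _ k1(1)] by (simp only: k1) simp
  have g1: "g \<cdot> qp1 C X A = a \<squnion> b"
    using join_components[OF _ k1(1)] unfolding k1(2,3)
    by (simp add: g_def k_def assoc_l_def)
  have g2: "g \<cdot> qp2 C X A = c"
    by (simp add: g_def k_def c_def r_def assoc_l_def)
  have abc: "a \<squnion> b \<bottom> c" using components_perp[OF _ _ typing(6)] by (simp only: g1 g2) simp
  have Iter_f: "wand_iter C (\<star>) X (X \<uplus> A) f = a \<star> r"
    unfolding a_def r_def using f by (intro wand_iter_eq) simp_all
  have ar_hom: "a \<star> r \<in> hom C X (X \<uplus> A)" by (rule wand_hom[OF typing(1,2) ar])
  have "wand_iter C (\<star>) X A (a \<star> r) = ((a \<star> r) \<cdot> qp1 C X A) \<star> ((a \<star> r) \<cdot> qp2 C X A)"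
    using ar_hom by (intro wand_iter_eq) simp_all
  \<comment> \<open>Naturality of the wand moves the quasi-projections onto the exit map
    \<open>r\<close>.\<close>
  also have "(a \<star> r) \<cdot> qp1 C X A = a \<star> b"
    unfolding b_def by (rule wand_natural[OF typing(1,2) _ ar]) (simp add: hom_iff)
  also have "(a \<star> r) \<cdot> qp2 C X A = a \<star> c"
    unfolding c_def by (rule wand_natural[OF typing(1,2) _ ar]) (simp add: hom_iff)
  also have "(a \<star> b) \<star> (a \<star> c) = (a \<squnion> b) \<star> c"
    by (rule wand_diagonal[OF typing(1,3,4) ab abc, symmetric])
  also have "\<dots> = wand_iter C (\<star>) X A g"
    using wand_iter_eq[OF _ _ typing(6)] by (simp only: g1 g2) simp
  finally show "wand_iter C (\<star>) X A (wand_iter C (\<star>) X (X \<uplus> A) f) =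
      wand_iter C (\<star>) X A (f \<cdot> assoc_l C X X A \<cdot> (codiag C 2 X \<oplus> idn C A))"
    unfolding Iter_f g_def k_def .
qed

sublocale iteration_category C "wand_iter C (\<star>)"
  by (intro iteration_category.intro wand_iter_operator) (rule cocartesian_restriction_category_axioms)

text \<open>Following the square for \<open>f\<close> and \<open>f'\<close> by the two
  quasi-projections gives exactly the two equations required for uniformity of the wand.\<close>

lemma uniform_wand_iter:
  assumes "uniform_wand C (\<star>)"
  shows "uniform_iteration C (wand_iter C (\<star>))"
  unfolding uniform_iteration_def
proof (intro ballI impI)
  fix X Y A f f' h
  assume Ob [simp]: "X \<in> Ob C" "Y \<in> Ob C" "A \<in> Ob C"
    and f: "f \<in> hom C X (X \<uplus> A)" and f': "f' \<in> hom C Y (Y \<uplus> A)" and h: "h \<in> hom C X Y"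
    and eq: "f \<cdot> (h \<oplus> idn C A) = h \<cdot> f'"
  note [simp] = f[unfolded hom_iff] f'[unfolded hom_iff] h[unfolded hom_iff]
  have "h \<cdot> f' \<cdot> qp1 C Y A = f \<cdot> qp1 C X A \<cdot> h" "h \<cdot> f' \<cdot> qp2 C Y A = f \<cdot> qp2 C X A"
    unfolding eq[symmetric] by simp_all
  then have "h \<cdot> (f' \<cdot> qp1 C Y A) = f \<cdot> qp1 C X A \<cdot> h" "h \<cdot> (f' \<cdot> qp2 C Y A) = f \<cdot> qp2 C X A"
    by simp_all
  with assms components_hom[OF _ _ f] components_hom[OF _ _ f'] h
    components_perp[OF _ _ f] components_perp[OF _ _ f'] Ob
  have "h \<cdot> ((f' \<cdot> qp1 C Y A) \<star> (f' \<cdot> qp2 C Y A)) = (f \<cdot> qp1 C X A) \<star> (f \<cdot> qp2 C X A)"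
    unfolding uniform_wand_def by blast
  then show "wand_iter C (\<star>) X A f = h \<cdot> wand_iter C (\<star>) Y A f'"
    using wand_iter_eq[OF _ _ f] wand_iter_eq[OF _ _ f'] by simp
qed

end

theorem proposition9p9:
  fixes C :: "('o, 'm, 'z) crcat_scheme" (structure)
    and wand :: "'m \<Rightarrow> 'm \<Rightarrow> 'm"  (infixl \<open>\<star>\<close> 70)
  assumes "extensive_restriction_category C"
    and "kleene_wand C (\<star>)"
  shows "(\<forall>X \<in> Ob C. \<forall>A \<in> Ob C. \<forall>f\<^sub>1 \<in> hom C X X. \<forall>f\<^sub>2 \<in> hom C X A.
            f\<^sub>1 \<bottom> f\<^sub>2 \<longrightarrow> wand_iter C (\<star>) X A (row C f\<^sub>1 f\<^sub>2) = f\<^sub>1 \<star> f\<^sub>2)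
       \<and> parametrized_iteration_operator C (wand_iter C (\<star>))
       \<and> (\<forall>X \<in> Ob C. \<forall>A \<in> Ob C. \<forall>B \<in> Ob C. \<forall>g \<in> hom C (X \<uplus> A) (X \<uplus> B).
            let g\<^sub>1 = in1 C X A \<cdot> g \<cdot> qp1 C X B;
                g\<^sub>2 = in1 C X A \<cdot> g \<cdot> qp2 C X B;
                g\<^sub>3 = in2 C X A \<cdot> g \<cdot> qp1 C X B;
                g\<^sub>4 = in2 C X A \<cdot> g \<cdot> qp2 C X B
            in g\<^sub>1 \<bottom> g\<^sub>2 \<and> g\<^sub>4 \<bottom> g\<^sub>3 \<cdot> (g\<^sub>1 \<star> g\<^sub>2) \<and>
               iter_trace C (wand_iter C (\<star>)) X A B g = g\<^sub>4 \<squnion> g\<^sub>3 \<cdot> (g\<^sub>1 \<star> g\<^sub>2))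
       \<and> traced_extensive_restriction_category C (iter_trace C (wand_iter C (\<star>)))
       \<and> (uniform_wand C (\<star>) \<longrightarrow>
            uniform_iteration C (wand_iter C (\<star>)) \<and>
            uniform_trace C (iter_trace C (wand_iter C (\<star>))))"
proof -
  interpret itegory C wand using assms by (rule itegory.intro)
  have trace: "let g\<^sub>1 = in1 C X A \<cdot> g \<cdot> qp1 C X B;
                g\<^sub>2 = in1 C X A \<cdot> g \<cdot> qp2 C X B;
                g\<^sub>3 = in2 C X A \<cdot> g \<cdot> qp1 C X B;
                g\<^sub>4 = in2 C X A \<cdot> g \<cdot> qp2 C X B
            in g\<^sub>1 \<bottom> g\<^sub>2 \<and> g\<^sub>4 \<bottom> g\<^sub>3 \<cdot> (g\<^sub>1 \<star> g\<^sub>2) \<and>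
               iter_trace C (wand_iter C (\<star>)) X A B g = g\<^sub>4 \<squnion> g\<^sub>3 \<cdot> (g\<^sub>1 \<star> g\<^sub>2)"
    if X: "X \<in> Ob C" and A: "A \<in> Ob C" and B: "B \<in> Ob C" and g: "g \<in> hom C (X \<uplus> A) (X \<uplus> B)"
    for X A B g
  proof -
    have h: "in1 C X A \<cdot> g \<in> hom C X (X \<uplus> B)" and k: "in2 C X A \<cdot> g \<in> hom C A (X \<uplus> B)"
      using X A B g by (simp_all add: hom_iff)
    \<comment> \<open>The typing of the loop value lets it serve as the map \<open>w\<close> in
      \<open>seq_copair_idn_eq_join\<close>, which yields both the second disjointness and the trace
      formula.\<close>
    note w = wand_iter_hom[OF X B h, unfolded wand_iter_eq[OF X B h]]
    show ?thesis
      unfolding Let_def iter_trace_def wand_iter_eq[OF X B h]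
      using components_perp[OF X B h] seq_copair_idn_eq_join[OF X k w] by blast
  qed
  show ?thesis
    using wand_iter_row wand_iter_operator trace iter_trace_operator uniform_wand_iter
      uniform_iter_trace extensive_restriction_category_axioms
    by (auto intro: traced_extensive_restriction_category.intro)
qed

end
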